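(* Let $n$ be a positive integer. The alternating group $A_n$ is a strongly real unmixed Beauville group if and only if $n\geq 6$.
   Context: Let $G$ be a finite group. An unmixed Beauville structure of $G$ is a pair of generating sets $\{x_i,y_i,z_i\}\subset G$, $i=1,2$ (each of which generates $G$), with orders $l_i=o(x_i)$, $m_i=o(y_i)$, $n_i=o(z_i)$, such that: (1) $x_iy_iz_i=1$ for $i=1,2$; (2) $\frac{1}{l_i}+\frac{1}{m_i}+\frac{1}{n_i}<1$ for $i=1,2$; (3) setting $\Sigma(x,y,z):=\bigcup_{g\in G}\bigcup_{j=0}^{\infty}\{gx^jg^{-1},gy^jg^{-1},gz^jg^{-1}\}$, one has $\Sigma(x_1,y_1,z_1)\cap\Sigma(x_2,y_2,z_2)=\{e\}$, where $e$ is the identity of $G$. Such a structure is strongly real if there exist automorphisms $\phi_1,\phi_2\in\mathrm{Aut}(G)$ that differ only by an inner automorphism of $G$ such that $x_i^{\phi_i}=x_i^{-1}$ and $y_i^{\phi_i}=y_i^{-1}$ for $i=1,2$. $G$ is a strongly real unmixed Beauville group if it possesses a strongly real unmixed Beauville structure. *)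

theory Defs
  imports Complex_Main "HOL-Algebra.Algebra"
begin

(* Triples are ordered: the labels of the three elements matter for the strongly real condition. *)
definition hyperbolic_generating_triple ::
    "('a, 'b) monoid_scheme \<Rightarrow> 'a \<Rightarrow> 'a \<Rightarrow> 'a \<Rightarrow> bool"
  where "hyperbolic_generating_triple G x y z \<longleftrightarrow>
    x \<in> carrier G \<and> y \<in> carrier G \<and> z \<in> carrier G \<and>
    generate G {x, y, z} = carrier G \<and>
    x \<otimes>\<^bsub>G\<^esub> y \<otimes>\<^bsub>G\<^esub> z = \<one>\<^bsub>G\<^esub> \<and>
    1 / real (group.ord G x) + 1 / real (group.ord G y) + 1 / real (group.ord G z) < 1"

definition conjugacy_union :: "('a, 'b) monoid_scheme \<Rightarrow> 'a \<Rightarrow> 'a \<Rightarrow> 'a \<Rightarrow> 'a set"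
  where "conjugacy_union G x y z =
    (\<Union>g \<in> carrier G. \<Union>j::nat.
      {g \<otimes>\<^bsub>G\<^esub> (x [^]\<^bsub>G\<^esub> j) \<otimes>\<^bsub>G\<^esub> inv\<^bsub>G\<^esub> g,
       g \<otimes>\<^bsub>G\<^esub> (y [^]\<^bsub>G\<^esub> j) \<otimes>\<^bsub>G\<^esub> inv\<^bsub>G\<^esub> g,
       g \<otimes>\<^bsub>G\<^esub> (z [^]\<^bsub>G\<^esub> j) \<otimes>\<^bsub>G\<^esub> inv\<^bsub>G\<^esub> g})"

definition unmixed_beauville_structure ::
    "('a, 'b) monoid_scheme \<Rightarrow> 'a \<times> 'a \<times> 'a \<Rightarrow> 'a \<times> 'a \<times> 'a \<Rightarrow> bool"
  where "unmixed_beauville_structure G = (\<lambda>(x1, y1, z1) (x2, y2, z2).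
    hyperbolic_generating_triple G x1 y1 z1 \<and>
    hyperbolic_generating_triple G x2 y2 z2 \<and>
    conjugacy_union G x1 y1 z1 \<inter> conjugacy_union G x2 y2 z2 = {\<one>\<^bsub>G\<^esub>})"

(* Restricted to the carrier, because the elements of AutoGroup G are extensional functions. *)
definition inner_auto :: "('a, 'b) monoid_scheme \<Rightarrow> 'a \<Rightarrow> ('a \<Rightarrow> 'a)"
  where "inner_auto G g = (\<lambda>x \<in> carrier G. g \<otimes>\<^bsub>G\<^esub> x \<otimes>\<^bsub>G\<^esub> inv\<^bsub>G\<^esub> g)"

(* The side on which the inner automorphism is multiplied is immaterial:
   inner automorphisms form a normal subgroup of AutoGroup G. *)
definition strongly_real_beauville_structure ::
    "('a, 'b) monoid_scheme \<Rightarrow> 'a \<times> 'a \<times> 'a \<Rightarrow> 'a \<times> 'a \<times> 'a \<Rightarrow> bool"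
  where "strongly_real_beauville_structure G = (\<lambda>(x1, y1, z1) (x2, y2, z2).
    unmixed_beauville_structure G (x1, y1, z1) (x2, y2, z2) \<and>
    (\<exists>\<phi>1 \<in> carrier (AutoGroup G). \<exists>\<phi>2 \<in> carrier (AutoGroup G).
      (\<exists>g \<in> carrier G. \<phi>2 = inner_auto G g \<otimes>\<^bsub>AutoGroup G\<^esub> \<phi>1) \<and>
      \<phi>1 x1 = inv\<^bsub>G\<^esub> x1 \<and> \<phi>1 y1 = inv\<^bsub>G\<^esub> y1 \<and>
      \<phi>2 x2 = inv\<^bsub>G\<^esub> x2 \<and> \<phi>2 y2 = inv\<^bsub>G\<^esub> y2))"

definition strongly_real_beauville_group :: "('a, 'b) monoid_scheme \<Rightarrow> bool"
  where "strongly_real_beauville_group G \<longleftrightarrow>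
    group G \<and> finite (carrier G) \<and>
    (\<exists>t1 t2. strongly_real_beauville_structure G t1 t2)"

end

theory Submission
  imports Defs
begin

text \<open>
  A permutation \<open>t\<close> conjugating \<open>x\<close> and \<open>y\<close> to their inverses gives the automorphism needed for one
  triple, and two such automorphisms differ by an inner one as soon as the two permutations
  have the same sign. The two sets of conjugates of powers are kept apart by the
  number of points that a permutation moves: it is invariant under conjugation, and if \<open>x\<close> is a single
  cycle of length \<open>l\<close>, then every nontrivial power of \<open>x\<close> moves exactly \<open>l\<close> points.

  The main source of triples are two cycles of odd length that run in opposite directions through a
  common interval \<open>L\<close> and through disjoint lists \<open>A\<close> and \<open>B\<close> otherwise. Their product is a cycle on the
  points of \<open>A\<close> and \<open>B\<close> and one end of \<open>L\<close>, and reversing \<open>L\<close>, \<open>A\<close> and \<open>B\<close> inverts both of them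
  (\<open>real_hyperbolic_pair_overlapping\<close>). The three cycles fix \<open>f1\<close>, \<open>f2\<close>, \<open>f3\<close> points with
  \<open>f1 + f2 + f3 = n - 1\<close>, and the sign of the reversal depends only on \<open>n\<close>. So it is enough to find two
  disjoint sets of values \<open>f1, f2, f3\<close>, all of the parity of \<open>n - 1\<close>. For even \<open>n \<ge> 10\<close>
  these are 1, 1, \<open>n - 3\<close> and 3, 3, \<open>n - 7\<close>; for odd \<open>n \<ge> 13\<close> they are 0, 2, \<open>n - 3\<close> and 4, 4, \<open>n - 9\<close>.

  That such cycles generate the alternating group is proved with a 3-cycle. Lying on a common 3-cycle of
  a permutation group is an equivalence relation preserved by the group, and if all points are
  equivalent, the group contains every 3-cycle (\<open>eq_alt_group_if_three_cycle\<close>). When \<open>A\<close> and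
  \<open>B\<close> have two points in total, the product of the two cycles is a 3-cycle. In the other cases the
  commutator of the two cycles is a product of two transpositions, and this meets one of its
  conjugates in a single point (\<open>generate_overlapping_long\<close>).

  In degrees 7, 8, 9 and 11 no two disjoint sets of values up to \<open>n - 3\<close> exist, and at least one of
  the two triples is given explicitly, with a word in the generators that is a 3-cycle. Degree 6 is special: the
  automorphism used there is not conjugation by a permutation of the six points, but comes from
  the action on the six synthematic totals.

  If \<open>n \<le> 5\<close>, an even permutation that is not a 5-cycle has order at most 3. A hyperbolic
  triple must therefore contain a 5-cycle. Any two subgroups generated by 5-cycles are conjugate
  in the alternating group of degree five, so the sets of conjugates of powers of two triples always share a
  nontrivial element (\<open>not_beauville_if_le_5\<close>).
\<close>

section \<open>Cycles\<close>

lemma cycle_of_list_append: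
  "cycle_of_list (xs @ c # ys) = cycle_of_list (xs @ [c]) \<circ> cycle_of_list (c # ys)"
proof (induction xs)
  case (Cons a xs)
  then show ?case by (cases xs) (simp_all add: comp_assoc)
qed simp

lemma bij_cycle_of_list: "bij (cycle_of_list cs)"
  by (simp add: permutation_bijective permutation_of_cycle)

lemma inv_cycle_of_list: "inv' (cycle_of_list cs) = cycle_of_list (rev cs)"
proof (induction cs rule: cycle_of_list.induct)
  case (1 i j cs)
  have "cycle_of_list (rev (i # j # cs)) = cycle_of_list (rev (j # cs)) \<circ> transpose i j"
    using cycle_of_list_append[of "rev cs" j "[i]"] by (simp add: transpose_commute)
  also have "\<dots> = inv' (transpose i j \<circ> cycle_of_list (j # cs))"
    using 1 by (simp add: o_inv_distrib bij_cycle_of_list)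
  finally show ?case by (simp only: cycle_of_list.simps)
qed (simp_all add: id_def)

lemma cycle_of_list_rotate:
  assumes "distinct (xs @ ys)"
  shows "cycle_of_list (xs @ ys) = cycle_of_list (ys @ xs)"
  using cycle_of_list_rotate_independent[OF assms, of "length xs"] by (simp add: rotate_append)

lemma cycle_of_list_succ:
  assumes "distinct (xs @ i # j # ys)"
  shows "cycle_of_list (xs @ i # j # ys) i = j"
proof -
  have "cycle_of_list ((i # j # ys) @ xs) i = j"
    using assms by (auto simp: id_outside_supp)
  then show ?thesis by (simp only: cycle_of_list_rotate[OF assms])
qed

lemma cycle_of_list_last:
  assumes "distinct (i # xs @ [j])"
  shows "cycle_of_list (i # xs @ [j]) j = i"
proof -
  have "cycle_of_list (i # xs @ [j]) = cycle_of_list ([] @ j # i # xs)"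
    using assms cycle_of_list_rotate[of "i # xs" "[j]"] by simp
  then show ?thesis using assms cycle_of_list_succ[of "[]" j i xs] by auto
qed

lemma sign_cycle_of_list:
  assumes "distinct cs"
  shows "sign (cycle_of_list cs) = (- 1) ^ (length cs - 1)"
  using assms
proof (induction cs rule: cycle_of_list.induct)
  case (1 i j cs)
  then show ?case
    using sign_compose[OF permutation_swap_id permutation_of_cycle, of i j "j # cs"]
    by (simp add: sign_swap_id comp_def)
qed (simp_all flip: id_def)

section \<open>Groups of even permutations containing a 3-cycle\<close>

text \<open>The relation of lying on a common 3-cycle of \<open>H\<close>. It turns out to be an equivalence relation that
\<open>H\<close> preserves, so that its classes are blocks of imprimitivity.\<close>

definition linked :: "(nat \<Rightarrow> nat) set \<Rightarrow> nat \<Rightarrow> nat \<Rightarrow> bool"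
  where "linked H i j \<longleftrightarrow> i = j \<or> (\<exists>k. distinct [i, j, k] \<and> cycle_of_list [i, j, k] \<in> H)"

context
  fixes n :: nat and H :: "(nat \<Rightarrow> nat) set"
  assumes H: "subgroup H (alt_group n)"
begin

lemma comp_closed: "p \<in> H \<Longrightarrow> q \<in> H \<Longrightarrow> p \<circ> q \<in> H"
  using subgroup.m_closed[OF H] by (simp add: alt_group_mult)

lemma inv_closed: "p \<in> H \<Longrightarrow> inv' p \<in> H"
  using subgroup.m_inv_closed[OF H] subgroup.mem_carrier[OF H] alt_group_inv_equality by metis

lemma bij_mem: "p \<in> H \<Longrightarrow> bij p"
  using subgroup.mem_carrier[OF H] alt_group_carrier' permutation_bijective by blast

lemma permutes_mem: "p \<in> H \<Longrightarrow> p permutes {1..n}"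
  using subgroup.mem_carrier[OF H] alt_group_carrier by blast

lemma conj_three_cycle:
  assumes "g \<in> H" "cycle_of_list [a, b, c] \<in> H" "distinct [a, b, c]"
  shows "cycle_of_list [g a, g b, g c] \<in> H"
  using conjugation_of_cycle[OF assms(3) bij_mem[OF assms(1)]]
    comp_closed[OF comp_closed[OF assms(1,2)] inv_closed[OF assms(1)]]
  by (simp only: list.map)

lemma rotate_three_cycle:
  "distinct [a, b, c] \<Longrightarrow> cycle_of_list [b, c, a] = cycle_of_list [a, b, c]"
  using cycle_of_list_rotate[of "[a]" "[b, c]"] by (simp del: cycle_of_list.simps)

lemma inv_three_cycle: "cycle_of_list [a, b, c] \<in> H \<Longrightarrow> cycle_of_list [c, b, a] \<in> H"
  using inv_closed[of "cycle_of_list [a, b, c]"] by (simp only: inv_cycle_of_list rev.simps append.simps)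

lemma linked_sym:
  assumes "linked H i j" shows "linked H j i"
proof (cases "i = j")
  case False
  then obtain k where k: "distinct [i, j, k]" "cycle_of_list [i, j, k] \<in> H"
    using assms unfolding linked_def by blast
  have "distinct [k, j, i]" using k(1) by auto
  from rotate_three_cycle[OF this] have "cycle_of_list [j, i, k] \<in> H"
    using inv_three_cycle[OF k(2)] by (simp only:)
  moreover have "distinct [j, i, k]" using k(1) by auto
  ultimately show ?thesis unfolding linked_def by blast
qed (simp add: linked_def)

lemma linked_three_cycle:
  assumes "cycle_of_list [a, b, c] \<in> H" "distinct [a, b, c]" "i \<in> {a, b, c}" "j \<in> {a, b, c}"
  shows "linked H i j"
proof -
  have link: "linked H u v" if "cycle_of_list [u, v, w] \<in> H" "distinct [u, v, w]" for u v w
    using that unfolding linked_def by blast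
  have rot: "cycle_of_list [b, c, a] \<in> H" "cycle_of_list [c, a, b] \<in> H"
    using assms(1) rotate_three_cycle[OF assms(2)] rotate_three_cycle[of b c a] assms(2)
    by (simp_all del: cycle_of_list.simps)
  have "linked H a b" "linked H b c" "linked H c a"
    using link[OF assms(1)] link[OF rot(1)] link[OF rot(2)] assms(2)
    by (simp_all del: cycle_of_list.simps)
  then have "linked H b a" "linked H c b" "linked H a c" by (auto intro: linked_sym)
  moreover have "linked H a a" "linked H b b" "linked H c c" unfolding linked_def by simp_all
  ultimately show ?thesis
    using assms(3,4) \<open>linked H a b\<close> \<open>linked H b c\<close> \<open>linked H c a\<close> by (elim insertE emptyE; simp only:)
qed

lemma linked_image:
  assumes "g \<in> H" "linked H i j"
  shows "linked H (g i) (g j)"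
proof (cases "i = j")
  case False
  then obtain k where k: "distinct [i, j, k]" "cycle_of_list [i, j, k] \<in> H"
    using assms(2) unfolding linked_def by blast
  moreover have "distinct [g i, g j, g k]"
    using k(1) bij_is_inj[OF bij_mem[OF assms(1)]] by (auto simp: inj_eq)
  ultimately show ?thesis using conj_three_cycle[OF assms(1)] unfolding linked_def by blast
qed (simp add: linked_def)

text \<open>Given 3-cycles \<open>(i j k)\<close> and \<open>(j l m)\<close> in \<open>H\<close> with \<open>l\<close> outside \<open>{i, j, k}\<close>, conjugating the second by the
inverse of the first moves \<open>j\<close> to \<open>i\<close> and keeps \<open>l\<close>.\<close>

lemma linked_trans:
  assumes "linked H i j" "linked H j l"
  shows "linked H i l"
proof (cases "i = j \<or> j = l")
  case True
  then show ?thesis using assms by auto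
next
  case False
  then obtain k m where k: "distinct [i, j, k]" "cycle_of_list [i, j, k] \<in> H"
    and m: "distinct [j, l, m]" "cycle_of_list [j, l, m] \<in> H"
    using assms unfolding linked_def by blast
  show ?thesis
  proof (cases "l \<in> {i, j, k}")
    case True
    then show ?thesis using linked_three_cycle[OF k(2,1)] by blast
  next
    case False
    define g where "g = cycle_of_list [k, j, i]"
    have "g \<in> H" unfolding g_def by (rule inv_three_cycle[OF k(2)])
    from linked_image[OF this linked_three_cycle[OF m(2,1), of j l]]
    have "linked H (g j) (g l)" by simp
    moreover have "g j = i" "g l = l" using False k(1) by (auto simp: g_def transpose_def)
    ultimately show ?thesis by simp
  qed
qed

text \<open>Some 3-cycle \<open>(a b k)\<close> lies in \<open>H\<close> and it remains to move \<open>k\<close> to \<open>c\<close>. A 3-cycle \<open>(k c m)\<close> does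
this by conjugation unless \<open>m\<close> is \<open>a\<close> or \<open>b\<close>; then all points involved are among \<open>a, b, c, k\<close> and
the 3-cycles found generate the alternating group on these four points.\<close>

lemma three_cycle_mem_if_linked:
  assumes tot: "\<And>i j. i \<in> {1..n} \<Longrightarrow> j \<in> {1..n} \<Longrightarrow> linked H i j"
    and d: "distinct [a, b, c]" and abc: "{a, b, c} \<subseteq> {1..n}"
  shows "cycle_of_list [a, b, c] \<in> H"
proof -
  obtain k where k: "distinct [a, b, k]" "cycle_of_list [a, b, k] \<in> H"
    using tot[of a b] d abc unfolding linked_def by auto
  have kn: "k \<in> {1..n}"
  proof (rule ccontr)
    assume "k \<notin> {1..n}"
    then have "cycle_of_list [a, b, k] k = k" using permutes_mem[OF k(2)] permutes_not_in by metis
    then show False using k(1) by (auto simp: transpose_def split: if_splits)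
  qed
  have *: "cycle_of_list [a, b, c] \<in> H" if "cycle_of_list [k, b, c] \<in> H" "distinct [k, b, c]"
  proof -
    have "cycle_of_list [a, c, b] \<in> H"
      using conj_three_cycle[OF that(1) k(2,1)] that(2) k(1) d by (auto simp: transpose_def)
    then have "cycle_of_list [b, c, a] \<in> H" by (rule inv_three_cycle)
    then show ?thesis using rotate_three_cycle[OF d] by simp
  qed
  show ?thesis
  proof (cases "c = k")
    case False
    then obtain m where m: "distinct [k, c, m]" "cycle_of_list [k, c, m] \<in> H"
      using tot[of k c] kn abc unfolding linked_def by auto
    note cj = conj_three_cycle[OF m(2) k(2,1)]
    consider "m = a" | "m = b" | "m \<noteq> a" "m \<noteq> b" by blast
    then show ?thesis
    proof cases
      case 1
      then have "cycle_of_list [k, b, c] \<in> H"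
        using cj m(1) k(1) d by (auto simp: transpose_def)
      then show ?thesis using * False k(1) d by auto
    next
      case 2
      have akc: "cycle_of_list [a, k, c] \<in> H"
        using cj m(1) k(1) d 2 by (auto simp: transpose_def)
      have "cycle_of_list [k, b, c] \<in> H"
        using conj_three_cycle[OF akc k(2,1)] k(1) d False by (auto simp: transpose_def)
      then show ?thesis using * False k(1) d by auto
    next
      case 3
      then show ?thesis using cj m(1) k(1) d by (auto simp: transpose_def split: if_splits)
    qed
  qed (use k in simp)
qed

lemma eq_alt_group_if_linked:
  assumes "\<And>i j. i \<in> {1..n} \<Longrightarrow> j \<in> {1..n} \<Longrightarrow> linked H i j"
  shows "H = carrier (alt_group n)"
proof
  show "H \<subseteq> carrier (alt_group n)" by (rule subgroup.subset[OF H])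
  have "three_cycles n \<subseteq> H"
  proof
    fix p assume "p \<in> three_cycles n"
    then obtain cs where cs: "p = cycle_of_list cs" "distinct cs" "length cs = 3" "set cs \<subseteq> {1..n}"
      by blast
    obtain a b c where abc: "cs = [a, b, c]" using stupid_lemma[OF cs(3)] by blast
    show "p \<in> H" using three_cycle_mem_if_linked[OF assms, of a b c] cs(2,4) unfolding cs(1) abc by simp
  qed
  then show "carrier (alt_group n) \<subseteq> H"
    unfolding alt_group_carrier_as_three_cycles
    by (rule group.generate_subgroup_incl[OF alt_group_is_group _ H])
qed

text \<open>A form of Jordan's theorem in which primitivity is replaced by a condition on some elements \<open>K\<close> of \<open>H\<close>. The class of \<open>a\<close> under
\<^const>\<open>linked\<close> is a block containing \<open>b\<close> and \<open>c\<close>; an element that maps one of the three points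
to one of the three points therefore fixes this block, and if the elements of \<open>K\<close> act
transitively, the block is everything.\<close>

lemma eq_alt_group_if_three_cycle:
  assumes c: "cycle_of_list [a, b, c] \<in> H" and d: "distinct [a, b, c]"
    and gens: "K \<subseteq> H" "\<And>g. g \<in> K \<Longrightarrow> \<exists>i \<in> {a, b, c}. g i \<in> {a, b, c}"
    and trans: "\<And>S. a \<in> S \<Longrightarrow> (\<And>g i. g \<in> K \<Longrightarrow> i \<in> S \<Longrightarrow> g i \<in> S) \<Longrightarrow> {1..n} \<subseteq> S"
  shows "H = carrier (alt_group n)"
proof -
  define S where "S = {i. linked H a i}"
  have abc: "{a, b, c} \<subseteq> S" unfolding S_def using linked_three_cycle[OF c d] by blast
  have "{1..n} \<subseteq> S"
  proof (rule trans)
    show "a \<in> S" using abc by simp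
    fix g i assume g: "g \<in> K" and i: "i \<in> S"
    obtain e where e: "e \<in> {a, b, c}" "g e \<in> {a, b, c}" using gens(2)[OF g] by blast
    have "linked H e i" using e(1) abc i linked_sym linked_trans unfolding S_def by blast
    then have "linked H (g e) (g i)" using linked_image gens(1) g by blast
    then show "g i \<in> S" using e(2) abc linked_trans unfolding S_def by blast
  qed
  then have "linked H i j" if "i \<in> {1..n}" "j \<in> {1..n}" for i j
    using that linked_sym linked_trans unfolding S_def by blast
  then show ?thesis by (rule eq_alt_group_if_linked)
qed

end

section \<open>Products of disjoint cycles\<close>

text \<open>Permutations are given by their cycles, so that powers, inverses, conjugates and signs can be read
off. The cycles are meant to be disjoint, which is expressed by \<open>distinct (concat cs)\<close>.\<close>

primrec cycles_perm :: "'a list list \<Rightarrow> 'a \<Rightarrow> 'a"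
  where "cycles_perm [] = id"
  | "cycles_perm (c # cs) = cycle_of_list c \<circ> cycles_perm cs"

definition card_moved :: "('a \<Rightarrow> 'a) \<Rightarrow> nat"
  where "card_moved p = card {a. p a \<noteq> a}"

text \<open>The \<open>j\<close>-th power of a cycle moves all of its points or none, so this is the number of points moved by
the \<open>j\<close>-th power of the permutation with disjoint cycles \<open>cs\<close>.\<close>

definition moved_count :: "'a list list \<Rightarrow> nat \<Rightarrow> nat"
  where "moved_count cs j = (\<Sum>c\<leftarrow>cs. if length c dvd j then 0 else length c)"

lemma eq_id_if_card_moved_eq_0:
  assumes "p permutes A" "finite A" "card_moved p = 0"
  shows "p = id"
proof -
  have "finite {a. p a \<noteq> a}"
    by (rule finite_subset[OF _ assms(2)]) (use permutes_not_in[OF assms(1)] in blast)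
  then show ?thesis using assms(3) unfolding card_moved_def by (auto simp: fun_eq_iff)
qed

lemma cycles_perm_permutes: "cycles_perm cs permutes set (concat cs)"
proof (induction cs)
  case (Cons c cs)
  have "cycle_of_list c permutes set (concat (c # cs))" "cycles_perm cs permutes set (concat (c # cs))"
    by (rule permutes_subset[OF cycle_permutes]; simp) (rule permutes_subset[OF Cons]; simp)
  then show ?case using permutes_compose unfolding cycles_perm.simps by blast
qed (simp add: id_def)

lemma sign_cycles_perm:
  "distinct (concat cs) \<Longrightarrow> sign (cycles_perm cs) = (- 1) ^ (\<Sum>c\<leftarrow>cs. length c - 1)"
proof (induction cs)
  case (Cons c cs)
  have "permutation (cycles_perm cs)"
    using cycles_perm_permutes[of cs] permutation_permutes by blast
  then show ?case
    using Cons sign_compose[OF permutation_of_cycle, of "cycles_perm cs" c]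
    by (simp add: sign_cycle_of_list power_add del: o_apply)
qed (simp add: sign_id)

lemma permutes_disjoint_commute:
  assumes p: "p permutes A" and q: "q permutes B" and AB: "A \<inter> B = {}"
  shows "p \<circ> q = q \<circ> p"
proof
  fix i
  consider "i \<in> A" | "i \<in> B" | "i \<notin> A \<union> B" by blast
  then show "(p \<circ> q) i = (q \<circ> p) i"
  proof cases
    case 1
    then have "q i = i" "q (p i) = p i"
      using AB permutes_in_image[OF p] permutes_not_in[OF q] by blast+
    then show ?thesis by simp
  next
    case 2
    then have "p i = i" "p (q i) = q i"
      using AB permutes_in_image[OF q] permutes_not_in[OF p] by blast+
    then show ?thesis by simp
  qed (simp add: permutes_not_in[OF p] permutes_not_in[OF q])
qed

lemma cycle_cycles_perm_commute:
  "distinct (concat (c # cs)) \<Longrightarrow> cycle_of_list c \<circ> cycles_perm cs = cycles_perm cs \<circ> cycle_of_list c"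
  by (rule permutes_disjoint_commute[OF cycle_permutes cycles_perm_permutes]) simp

lemma inv_cycles_perm:
  "distinct (concat cs) \<Longrightarrow> inv' (cycles_perm cs) = cycles_perm (map rev cs)"
proof (induction cs)
  case (Cons c cs)
  have "bij (cycles_perm cs)" using cycles_perm_permutes permutes_bij by blast
  then have "inv' (cycles_perm cs \<circ> cycle_of_list c) = cycles_perm (map rev (c # cs))"
    using Cons by (simp add: o_inv_distrib bij_cycle_of_list inv_cycle_of_list)
  then show ?case using cycle_cycles_perm_commute[OF Cons.prems] by (simp only: cycles_perm.simps)
qed (simp add: id_def)

lemma conj_cycles_perm:
  "bij t \<Longrightarrow> distinct (concat cs) \<Longrightarrow> t \<circ> cycles_perm cs \<circ> inv' t = cycles_perm (map (map t) cs)"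
proof (induction cs)
  case Nil
  then show ?case by (simp add: fun_eq_iff bij_is_surj surj_f_inv_f)
next
  case (Cons c cs)
  have "t \<circ> cycles_perm (c # cs) \<circ> inv' t
    = (t \<circ> cycle_of_list c \<circ> inv' t) \<circ> (t \<circ> cycles_perm cs \<circ> inv' t)"
    using Cons.prems(1) by (auto simp: fun_eq_iff bij_is_inj)
  also have "t \<circ> cycle_of_list c \<circ> inv' t = cycle_of_list (map t c)"
    using Cons.prems by (intro conjugation_of_cycle) auto
  also have "t \<circ> cycles_perm cs \<circ> inv' t = cycles_perm (map (map t) cs)"
    using Cons.prems by (intro Cons.IH) auto
  finally show ?case by simp
qed

lemma funpow_comp_commute:
  assumes "p \<circ> q = q \<circ> p"
  shows "(p \<circ> q) ^^ j = p ^^ j \<circ> q ^^ j"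
proof (induction j)
  case (Suc j)
  have *: "q \<circ> p ^^ j = p ^^ j \<circ> q"
  proof (induction j)
    case (Suc j)
    have "q \<circ> p ^^ Suc j = (q \<circ> p) \<circ> p ^^ j" by (simp only: funpow.simps comp_assoc)
    also have "\<dots> = p \<circ> (q \<circ> p ^^ j)" by (simp only: comp_assoc flip: assms)
    also have "\<dots> = p ^^ Suc j \<circ> q" by (simp only: comp_assoc Suc funpow.simps)
    finally show ?case .
  qed simp
  have "(p \<circ> q) ^^ Suc j = p \<circ> (q \<circ> p ^^ j) \<circ> q ^^ j" by (simp only: comp_assoc Suc funpow.simps)
  also have "\<dots> = p ^^ Suc j \<circ> q ^^ Suc j" unfolding * by (simp only: comp_assoc funpow.simps)
  finally show ?case .
qed simp

lemma cycle_of_list_funpow_nth: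
  assumes "distinct c" "i < length c"
  shows "(cycle_of_list c ^^ j) (c ! i) = c ! ((j + i) mod length c)"
proof -
  have "(cycle_of_list c ^^ j) (c ! i) = map (cycle_of_list c ^^ j) c ! i" using assms(2) by simp
  also have "\<dots> = rotate j c ! i" by (simp only: cyclic_rotation[OF assms(1)])
  finally show ?thesis using assms(2) by (simp add: nth_rotate)
qed

lemma moved_cycle_of_list_funpow:
  assumes "distinct c"
  shows "{a. (cycle_of_list c ^^ j) a \<noteq> a} = (if length c dvd j then {} else set c)"
proof -
  have out: "(cycle_of_list c ^^ j) a = a" if "a \<notin> set c" for a
    using permutes_not_in[OF permutes_funpow[OF cycle_permutes] that] .
  have "(cycle_of_list c ^^ j) (c ! i) = c ! i \<longleftrightarrow> length c dvd j" if i: "i < length c" for i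
  proof -
    have "(cycle_of_list c ^^ j) (c ! i) = c ! i \<longleftrightarrow> (j + i) mod length c = i"
      using i cycle_of_list_funpow_nth[OF assms i] nth_eq_iff_index_eq[OF assms]
      by (metis i length_pos_if_in_set mod_less_divisor nth_mem)
    also have "\<dots> \<longleftrightarrow> (j + i) mod length c = i mod length c" using i by simp
    also have "\<dots> \<longleftrightarrow> length c dvd j" using mod_eq_dvd_iff_nat[of i "j + i"] by auto
    finally show ?thesis .
  qed
  then have "(cycle_of_list c ^^ j) a = a \<longleftrightarrow> length c dvd j" if "a \<in> set c" for a
    using that by (metis in_set_conv_nth)
  then show ?thesis using out by auto
qed

lemma card_moved_cycles_perm_funpow:
  "distinct (concat cs) \<Longrightarrow> card_moved (cycles_perm cs ^^ j) = moved_count cs j"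
proof (induction cs)
  case Nil
  then show ?case by (simp add: card_moved_def moved_count_def id_funpow flip: id_def)
next
  case (Cons c cs)
  let ?p = "cycle_of_list c ^^ j" and ?q = "cycles_perm cs ^^ j"
  have p: "?p permutes set c" and q: "?q permutes set (concat cs)"
    by (rule permutes_funpow[OF cycle_permutes], rule permutes_funpow[OF cycles_perm_permutes])
  have disj: "set c \<inter> set (concat cs) = {}" using Cons.prems by simp
  have pow: "cycles_perm (c # cs) ^^ j = ?p \<circ> ?q"
    unfolding cycles_perm.simps by (rule funpow_comp_commute[OF cycle_cycles_perm_commute[OF Cons.prems]])
  have comm: "?p \<circ> ?q = ?q \<circ> ?p" by (rule permutes_disjoint_commute[OF p q disj])
  have "{a. (?p \<circ> ?q) a \<noteq> a} = {a. ?p a \<noteq> a} \<union> {a. ?q a \<noteq> a}"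
  proof (rule Set.set_eqI)
    fix a
    have "?p a = a \<or> ?q a = a" using permutes_not_in[OF p] permutes_not_in[OF q] disj by blast
    then show "a \<in> {a. (?p \<circ> ?q) a \<noteq> a} \<longleftrightarrow> a \<in> {a. ?p a \<noteq> a} \<union> {a. ?q a \<noteq> a}"
      using fun_cong[OF comm, of a] by auto
  qed
  moreover have "{a. ?p a \<noteq> a} \<inter> {a. ?q a \<noteq> a} = {}"
    using permutes_not_in[OF p] permutes_not_in[OF q] disj by blast
  moreover have "finite {a. ?p a \<noteq> a}" "finite {a. ?q a \<noteq> a}"
    using permutes_not_in[OF p] permutes_not_in[OF q]
    by (auto intro: finite_subset[of _ "set c"] finite_subset[of _ "set (concat cs)"] simp del: set_concat)
  ultimately have "card_moved (?p \<circ> ?q) = card {a. ?p a \<noteq> a} + card_moved ?q"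
    unfolding card_moved_def by (simp add: card_Un_disjoint)
  also have "card {a. ?p a \<noteq> a} = (if length c dvd j then 0 else length c)"
    using Cons.prems moved_cycle_of_list_funpow[of c j] distinct_card[of c] by simp
  also have "card_moved ?q = moved_count cs j" using Cons by simp
  finally show ?case unfolding pow moved_count_def by (simp only: list.map sum_list.Cons)
qed

lemma length_dvd_if_cycles_perm_funpow_eq_id:
  assumes "distinct (concat cs)" "cycles_perm cs ^^ j = id" "c \<in> set cs"
  shows "length c dvd j \<or> length c = 0"
proof -
  have "moved_count cs j = 0"
    using card_moved_cycles_perm_funpow[OF assms(1), of j] assms(2) by (simp add: card_moved_def)
  then show ?thesis using assms(3) unfolding moved_count_def by (auto split: if_splits)
qed

section \<open>Beauville structures from pairs of permutations\<close>

lemma alt_group_nat_pow: "p [^]\<^bsub>alt_group n\<^esub> (j::nat) = p ^^ j"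
proof (induction j)
  case 0
  then show ?case by (simp add: nat_pow_def alt_group_one)
next
  case (Suc j)
  then show ?case
    unfolding funpow_Suc_right by (simp add: nat_pow_def alt_group_mult)
qed

lemma sign_one_iff_evenperm: "sign p = 1 \<longleftrightarrow> evenperm p"
  by (simp add: sign_def)

lemma alt_group_carrier_sign: "p \<in> carrier (alt_group n) \<longleftrightarrow> p permutes {1..n} \<and> sign p = 1"
  by (simp add: alt_group_carrier sign_one_iff_evenperm)

lemma card_moved_conj:
  assumes "bij g"
  shows "card_moved (g \<circ> p \<circ> inv' g) = card_moved p"
proof -
  have "{a. (g \<circ> p \<circ> inv' g) a \<noteq> a} = g ` {a. p a \<noteq> a}"
    using assms by (auto simp: bij_image_Collect_eq bij_inv_eq_iff)
  then show ?thesis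
    unfolding card_moved_def using card_image[OF inj_on_subset[OF bij_is_inj[OF assms] subset_UNIV]] by simp
qed

lemma card_moved_inv:
  assumes "bij p"
  shows "card_moved (inv' p) = card_moved p"
proof -
  have "inv' p a = a \<longleftrightarrow> p a = a" for a using assms by (metis bij_inv_eq_iff)
  then show ?thesis unfolding card_moved_def by simp
qed

text \<open>A hyperbolic generating triple is determined by its first two entries. The set \<open>M\<close> contains the
numbers of points moved by the nontrivial powers of \<open>x\<close>, \<open>y\<close> and \<open>x \<circ> y\<close>; since these numbers
are invariant under conjugation, they separate the sets \<^const>\<open>conjugacy_union\<close> of two triples.\<close>

definition hyperbolic_pair :: "nat \<Rightarrow> nat set \<Rightarrow> (nat \<Rightarrow> nat) \<Rightarrow> (nat \<Rightarrow> nat) \<Rightarrow> bool"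
  where "hyperbolic_pair n M x y \<longleftrightarrow>
    x \<in> carrier (alt_group n) \<and> y \<in> carrier (alt_group n) \<and>
    generate (alt_group n) {x, y} = carrier (alt_group n) \<and>
    1 / real (group.ord (alt_group n) x) + 1 / real (group.ord (alt_group n) y)
      + 1 / real (group.ord (alt_group n) (x \<circ> y)) < 1 \<and>
    (\<forall>p \<in> {x, y, x \<circ> y}. \<forall>j. p ^^ j \<noteq> id \<longrightarrow> card_moved (p ^^ j) \<in> M)"

lemma hyperbolic_triple_if_pair:
  assumes "hyperbolic_pair n M x y"
  shows "hyperbolic_generating_triple (alt_group n) x y (inv' (x \<circ> y))"
proof -
  interpret A: group "alt_group n" by (rule alt_group_is_group)
  note p = assms[unfolded hyperbolic_pair_def]
  have x: "x \<in> carrier (alt_group n)" and y: "y \<in> carrier (alt_group n)" using p by auto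
  have xy: "x \<circ> y \<in> carrier (alt_group n)" using A.m_closed[OF x y] by (simp add: alt_group_mult)
  have inv: "inv' (x \<circ> y) = inv\<^bsub>alt_group n\<^esub> (x \<circ> y)" using alt_group_inv_equality[OF xy] by simp
  have z: "inv' (x \<circ> y) \<in> carrier (alt_group n)" unfolding inv using xy by simp
  have "carrier (alt_group n) \<subseteq> generate (alt_group n) {x, y, inv' (x \<circ> y)}"
    using A.mono_generate[of "{x, y}" "{x, y, inv' (x \<circ> y)}"] p by auto
  moreover have "generate (alt_group n) {x, y, inv' (x \<circ> y)} \<subseteq> carrier (alt_group n)"
    using A.generate_in_carrier[of "{x, y, inv' (x \<circ> y)}"] x y z by auto
  moreover have "x \<otimes>\<^bsub>alt_group n\<^esub> y \<otimes>\<^bsub>alt_group n\<^esub> inv' (x \<circ> y) = \<one>\<^bsub>alt_group n\<^esub>"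
    using A.r_inv[OF xy] unfolding inv by (simp add: alt_group_mult)
  moreover have "group.ord (alt_group n) (inv' (x \<circ> y)) = group.ord (alt_group n) (x \<circ> y)"
    unfolding inv using xy by simp
  ultimately show ?thesis
    unfolding hyperbolic_generating_triple_def using p x y z by simp
qed

lemma card_moved_conjugacy_union:
  assumes "hyperbolic_pair n M x y"
    and p: "p \<in> conjugacy_union (alt_group n) x y (inv' (x \<circ> y))"
  shows "p = id \<or> card_moved p \<in> M"
proof (cases "p = id")
  case False
  interpret A: group "alt_group n" by (rule alt_group_is_group)
  note pr = assms(1)[unfolded hyperbolic_pair_def]
  have x: "x \<in> carrier (alt_group n)" and y: "y \<in> carrier (alt_group n)" using pr by auto
  have xy: "x \<circ> y \<in> carrier (alt_group n)" using A.m_closed[OF x y] by (simp add: alt_group_mult)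
  obtain g q j where g: "g \<in> carrier (alt_group n)" and q: "q \<in> {x, y, inv' (x \<circ> y)}"
    and "p = g \<otimes>\<^bsub>alt_group n\<^esub> q [^]\<^bsub>alt_group n\<^esub> (j::nat) \<otimes>\<^bsub>alt_group n\<^esub> inv\<^bsub>alt_group n\<^esub> g"
    using p unfolding conjugacy_union_def by blast
  then have p_eq: "p = g \<circ> q ^^ j \<circ> inv' g"
    by (simp add: alt_group_mult alt_group_nat_pow alt_group_inv_equality)
  have "bij g" using g alt_group_carrier' permutation_bijective by blast
  then have card: "card_moved p = card_moved (q ^^ j)" unfolding p_eq by (rule card_moved_conj)
  have "q ^^ j \<noteq> id"
  proof
    assume "q ^^ j = id"
    then have "p = g \<circ> inv' g" unfolding p_eq by simp
    also have "\<dots> = id" using \<open>bij g\<close> by (simp add: bij_is_surj flip: surj_iff)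
    finally show False using False by contradiction
  qed
  have "card_moved p \<in> M"
  proof (cases "q = inv' (x \<circ> y)")
    case True
    have inv: "q ^^ j = inv' ((x \<circ> y) ^^ j)"
    proof -
      have "q = inv\<^bsub>alt_group n\<^esub> (x \<circ> y)" using alt_group_inv_equality[OF xy] True by simp
      then have "q [^]\<^bsub>alt_group n\<^esub> j = inv\<^bsub>alt_group n\<^esub> ((x \<circ> y) [^]\<^bsub>alt_group n\<^esub> j)"
        using A.nat_pow_inv[OF xy] by simp
      then show ?thesis
        using alt_group_inv_equality[OF A.nat_pow_closed[OF xy, of j]] by (simp add: alt_group_nat_pow)
    qed
    have b: "bij ((x \<circ> y) ^^ j)"
      using permutation_funpow[OF alt_group_carrier'[OF xy]] permutation_bijective by blast
    have "(x \<circ> y) ^^ j \<noteq> id" using \<open>q ^^ j \<noteq> id\<close> unfolding inv by auto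
    then show ?thesis using pr card_moved_inv[OF b] unfolding card inv by auto
  qed (use q pr \<open>q ^^ j \<noteq> id\<close> card in auto)
  then show ?thesis ..
qed simp

lemma unmixed_beauville_structure_alt_groupI:
  assumes "hyperbolic_pair n M1 x1 y1" "hyperbolic_pair n M2 x2 y2" "M1 \<inter> M2 = {}"
  shows "unmixed_beauville_structure (alt_group n) (x1, y1, inv' (x1 \<circ> y1)) (x2, y2, inv' (x2 \<circ> y2))"
proof -
  interpret A: group "alt_group n" by (rule alt_group_is_group)
  have one: "\<one>\<^bsub>alt_group n\<^esub> \<in> conjugacy_union (alt_group n) x y z" for x y z
    unfolding conjugacy_union_def
    by (rule UN_I[of "\<one>\<^bsub>alt_group n\<^esub>"], simp, rule UN_I[of 0]) simp_all
  have "p = id" if "p \<in> conjugacy_union (alt_group n) x1 y1 (inv' (x1 \<circ> y1))"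
    "p \<in> conjugacy_union (alt_group n) x2 y2 (inv' (x2 \<circ> y2))" for p
    using that card_moved_conjugacy_union[OF assms(1)] card_moved_conjugacy_union[OF assms(2)] assms(3)
    by blast
  then have "conjugacy_union (alt_group n) x1 y1 (inv' (x1 \<circ> y1))
      \<inter> conjugacy_union (alt_group n) x2 y2 (inv' (x2 \<circ> y2)) = {\<one>\<^bsub>alt_group n\<^esub>}"
    using one unfolding alt_group_one by blast
  then show ?thesis
    unfolding unmixed_beauville_structure_def
    using hyperbolic_triple_if_pair[OF assms(1)] hyperbolic_triple_if_pair[OF assms(2)] by simp
qed

lemma strongly_real_alt_groupI:
  assumes pairs: "hyperbolic_pair n M1 x1 y1" "hyperbolic_pair n M2 x2 y2" "M1 \<inter> M2 = {}"
    and auts: "\<phi>1 \<in> carrier (AutoGroup (alt_group n))" "\<phi>2 \<in> carrier (AutoGroup (alt_group n))"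
    and g: "g \<in> carrier (alt_group n)" "\<phi>2 = inner_auto (alt_group n) g \<otimes>\<^bsub>AutoGroup (alt_group n)\<^esub> \<phi>1"
    and inverts: "\<phi>1 x1 = inv' x1" "\<phi>1 y1 = inv' y1" "\<phi>2 x2 = inv' x2" "\<phi>2 y2 = inv' y2"
  shows "strongly_real_beauville_group (alt_group n)"
proof -
  have "x1 \<in> carrier (alt_group n)" "y1 \<in> carrier (alt_group n)"
    "x2 \<in> carrier (alt_group n)" "y2 \<in> carrier (alt_group n)"
    using pairs(1,2) unfolding hyperbolic_pair_def by auto
  then have "strongly_real_beauville_structure (alt_group n)
      (x1, y1, inv' (x1 \<circ> y1)) (x2, y2, inv' (x2 \<circ> y2))"
    unfolding strongly_real_beauville_structure_def
    using unmixed_beauville_structure_alt_groupI[OF pairs] auts g inverts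
    by (auto simp: alt_group_inv_equality)
  moreover have "finite (carrier (alt_group n))"
    by (rule finite_subset[of _ "{p. p permutes {1..n}}"]) (auto simp: alt_group_carrier finite_permutations)
  ultimately show ?thesis
    unfolding strongly_real_beauville_group_def using alt_group_is_group by blast
qed

text \<open>The permutation \<open>t\<close> may be odd: conjugation by it is then an automorphism that need not be inner.\<close>

lemma conjugation_in_auto:
  assumes t: "t permutes {1..n}"
  shows "(\<lambda>p \<in> carrier (alt_group n). t \<circ> p \<circ> inv' t) \<in> carrier (AutoGroup (alt_group n))"
proof -
  let ?G = "alt_group n"
  have closed: "s \<circ> p \<circ> inv' s \<in> carrier ?G" if s: "s permutes {1..n}" and p: "p \<in> carrier ?G" for s p
  proof -
    have ps: "permutation p" "permutation s" "permutation (inv' s)"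
      using p s permutes_inv[OF s] alt_group_carrier' permutation_permutes by blast+
    have sgn: "sign (s \<circ> p \<circ> inv' s) = sign s * sign p * sign s"
      using ps sign_inverse[OF ps(2)] by (simp only: sign_compose permutation_compose)
    also have "\<dots> = 1" using p by (simp add: alt_group_carrier_sign)
    finally have "sign (s \<circ> p \<circ> inv' s) = 1" .
    moreover have "s \<circ> p \<circ> inv' s permutes {1..n}"
      using p s permutes_inv[OF s] by (intro permutes_compose) (auto simp: alt_group_carrier)
    ultimately show ?thesis unfolding alt_group_carrier_sign by blast
  qed
  have b: "inv' t \<circ> t = id" "t \<circ> inv' t = id" using permutes_inv_o[OF t] by auto
  have cancel: "t \<circ> (inv' t \<circ> p \<circ> t) \<circ> inv' t = p" "inv' t \<circ> (t \<circ> p \<circ> inv' t) \<circ> t = p" for p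
    using permutes_inverses[OF t] by (auto simp: fun_eq_iff)
  have closed_inv: "inv' t \<circ> p \<circ> t \<in> carrier ?G" if "p \<in> carrier ?G" for p
    using closed[OF permutes_inv[OF t] that] permutes_inv_inv[OF t] by simp
  have "bij_betw (\<lambda>p. t \<circ> p \<circ> inv' t) (carrier ?G) (carrier ?G)"
    by (rule bij_betw_byWitness[where f' = "\<lambda>p. inv' t \<circ> p \<circ> t"])
      (use closed[OF t] closed_inv cancel in auto)
  then have "bij_betw (\<lambda>p \<in> carrier ?G. t \<circ> p \<circ> inv' t) (carrier ?G) (carrier ?G)"
    by (simp add: bij_betw_restrict_eq)
  moreover have "(\<lambda>p \<in> carrier ?G. t \<circ> p \<circ> inv' t) \<in> hom ?G ?G"
  proof (rule homI)
    fix p q assume pq: "p \<in> carrier ?G" "q \<in> carrier ?G"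
    then have "p \<circ> q \<in> carrier ?G"
      using group.is_monoid[OF alt_group_is_group, of n] monoid.m_closed[of ?G p q] by (simp add: alt_group_mult)
    moreover have "t \<circ> (p \<circ> q) \<circ> inv' t = (t \<circ> p \<circ> inv' t) \<circ> (t \<circ> q \<circ> inv' t)"
      using permutes_inverses[OF t] by (auto simp: fun_eq_iff)
    ultimately show "(\<lambda>p \<in> carrier ?G. t \<circ> p \<circ> inv' t) (p \<otimes>\<^bsub>?G\<^esub> q)
      = (\<lambda>p \<in> carrier ?G. t \<circ> p \<circ> inv' t) p \<otimes>\<^bsub>?G\<^esub> (\<lambda>p \<in> carrier ?G. t \<circ> p \<circ> inv' t) q"
      using pq by (simp only: alt_group_mult restrict_apply if_True)
  qed (use closed[OF t] in auto)
  ultimately show ?thesis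
    unfolding AutoGroup_def auto_def Bij_def by simp
qed

text \<open>Conjugation by \<open>t2\<close> is conjugation by \<open>t1\<close> followed by conjugation by \<open>t2 \<circ> inv t1\<close>. Equality of the signs
makes this last permutation even, so the two automorphisms differ by an inner one.\<close>

lemma strongly_real_alt_group_if_conj:
  assumes pairs: "hyperbolic_pair n M1 x1 y1" "hyperbolic_pair n M2 x2 y2" "M1 \<inter> M2 = {}"
    and t: "t1 permutes {1..n}" "t2 permutes {1..n}" "sign t1 = sign t2"
    and inverts: "t1 \<circ> x1 \<circ> inv' t1 = inv' x1" "t1 \<circ> y1 \<circ> inv' t1 = inv' y1"
      "t2 \<circ> x2 \<circ> inv' t2 = inv' x2" "t2 \<circ> y2 \<circ> inv' t2 = inv' y2"
  shows "strongly_real_beauville_group (alt_group n)"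
proof -
  let ?G = "alt_group n"
  let ?c = "\<lambda>t. \<lambda>p \<in> carrier ?G. t \<circ> p \<circ> inv' t"
  have mem: "x1 \<in> carrier ?G" "y1 \<in> carrier ?G" "x2 \<in> carrier ?G" "y2 \<in> carrier ?G"
    using pairs(1,2) unfolding hyperbolic_pair_def by auto
  have ps: "permutation t1" "permutation t2" "permutation (inv' t1)"
    using t permutes_inv[OF t(1)] permutation_permutes by blast+
  let ?g = "t2 \<circ> inv' t1"
  have "sign ?g = sign t2 * sign t1"
    using ps sign_inverse[OF ps(1)] by (simp only: sign_compose)
  then have "sign ?g = 1" using t(3) by simp
  moreover have "?g permutes {1..n}" using t(1,2) permutes_inv permutes_compose by blast
  ultimately have g: "?g \<in> carrier ?G" unfolding alt_group_carrier_sign by blast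
  have inv_g: "inv' ?g = t1 \<circ> inv' t2"
    using o_inv_distrib[OF permutes_bij[OF t(2)] permutes_bij[OF permutes_inv[OF t(1)]]]
      permutes_inv_inv[OF t(1)] by (simp only:)
  have inner: "inner_auto ?G ?g = ?c ?g"
    unfolding inner_auto_def alt_group_mult using alt_group_inv_equality[OF g] by simp
  have auts: "?c t \<in> Bij (carrier ?G)" if "t permutes {1..n}" for t
    using conjugation_in_auto[OF that] unfolding AutoGroup_def auto_def by simp
  have "?c t2 = compose (carrier ?G) (?c ?g) (?c t1)"
  proof (rule extensionalityI[where A = "carrier ?G"])
    fix p assume p: "p \<in> carrier ?G"
    have tp: "t1 \<circ> p \<circ> inv' t1 \<in> carrier ?G"
      using funcset_mem[OF Bij_imp_funcset[OF auts[OF t(1)]] p] p by (simp only: restrict_apply if_True)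
    have "?g \<circ> (t1 \<circ> p \<circ> inv' t1) \<circ> inv' ?g = t2 \<circ> p \<circ> inv' t2"
      unfolding inv_g using permutes_inverses[OF t(1)] by (auto simp: fun_eq_iff)
    then show "?c t2 p = compose (carrier ?G) (?c ?g) (?c t1) p"
      using p tp by (simp only: compose_eq restrict_apply if_True)
  qed auto
  also have "\<dots> = inner_auto ?G ?g \<otimes>\<^bsub>AutoGroup ?G\<^esub> ?c t1"
    unfolding inner AutoGroup_def BijGroup_def
    using auts[OF t(1)] auts[of ?g] g by (simp add: alt_group_carrier)
  finally have "?c t2 = inner_auto ?G ?g \<otimes>\<^bsub>AutoGroup ?G\<^esub> ?c t1" .
  then show ?thesis
    by (rule strongly_real_alt_groupI[OF pairs conjugation_in_auto[OF t(1)] conjugation_in_auto[OF t(2)] g])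
      (use mem inverts in \<open>simp_all only: restrict_apply if_True\<close>)
qed

text \<open>The case of a single automorphism for both triples; the inner automorphism is the identity.\<close>

lemma strongly_real_alt_group_if_auto:
  assumes pairs: "hyperbolic_pair n M1 x1 y1" "hyperbolic_pair n M2 x2 y2" "M1 \<inter> M2 = {}"
    and aut: "\<phi> \<in> carrier (AutoGroup (alt_group n))"
    and inverts: "\<phi> x1 = inv' x1" "\<phi> y1 = inv' y1" "\<phi> x2 = inv' x2" "\<phi> y2 = inv' y2"
  shows "strongly_real_beauville_group (alt_group n)"
proof -
  interpret A: group "alt_group n" by (rule alt_group_is_group)
  interpret Aut: group "AutoGroup (alt_group n)" by (rule A.AutoGroup)
  have "inner_auto (alt_group n) \<one>\<^bsub>alt_group n\<^esub> = \<one>\<^bsub>AutoGroup (alt_group n)\<^esub>"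
    unfolding inner_auto_def AutoGroup_def BijGroup_def by (auto simp: fun_eq_iff restrict_def)
  then show ?thesis
    using strongly_real_alt_groupI[OF pairs aut aut A.one_closed _ inverts] aut by simp
qed

lemma length_le_ord_cycles_perm:
  assumes "distinct (concat cs)" "cycles_perm cs \<in> carrier (alt_group n)" "c \<in> set cs"
  shows "length c \<le> group.ord (alt_group n) (cycles_perm cs)"
proof -
  interpret A: group "alt_group n" by (rule alt_group_is_group)
  have "finite (carrier (alt_group n))"
    by (rule finite_subset[of _ "{p. p permutes {1..n}}"]) (auto simp: alt_group_carrier finite_permutations)
  then have "group.ord (alt_group n) (cycles_perm cs) \<ge> 1" using A.ord_ge_1 assms(2) by blast
  moreover have "cycles_perm cs ^^ group.ord (alt_group n) (cycles_perm cs) = id"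
    using A.pow_ord_eq_1[OF assms(2)] by (simp add: alt_group_nat_pow alt_group_one)
  ultimately show ?thesis
    using length_dvd_if_cycles_perm_funpow_eq_id[OF assms(1) _ assms(3)] dvd_imp_le by fastforce
qed

text \<open>Each cycle of length \<open>l\<close> contributes \<open>(-1) ^ (l - 1)\<close> to the sign, so the last condition says
that the permutation is even.\<close>

definition even_cycles :: "nat \<Rightarrow> nat list list \<Rightarrow> bool"
  where "even_cycles n cs \<longleftrightarrow> distinct (concat cs) \<and> set (concat cs) \<subseteq> {1..n} \<and> even (\<Sum>c\<leftarrow>cs. length c - 1)"

lemma cycles_perm_in_alt_group:
  "even_cycles n cs \<Longrightarrow> cycles_perm cs \<in> carrier (alt_group n)"
  unfolding even_cycles_def alt_group_carrier_sign
  using sign_cycles_perm[of cs] permutes_subset[OF cycles_perm_permutes] by auto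

text \<open>Lower bounds on the three orders, read off from one cycle of each permutation, are enough for the
hyperbolic inequality. The value 0 is admitted for \<^const>\<open>moved_count\<close> because it stands for trivial powers.\<close>

lemma hyperbolic_pairI:
  assumes cycles: "even_cycles n cx" "even_cycles n cy" "distinct (concat cw)"
    and w: "cycles_perm cx \<circ> cycles_perm cy = cycles_perm cw"
    and gen: "generate (alt_group n) {cycles_perm cx, cycles_perm cy} = carrier (alt_group n)"
    and long: "a \<in> set cx" "b \<in> set cy" "c \<in> set cw" "length a \<ge> 1" "length b \<ge> 1" "length c \<ge> 1"
      "1 / real (length a) + 1 / real (length b) + 1 / real (length c) < 1"
    and M: "\<And>cs j. cs \<in> {cx, cy, cw} \<Longrightarrow> moved_count cs j \<in> insert 0 M"
  shows "hyperbolic_pair n M (cycles_perm cx) (cycles_perm cy)"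
proof -
  interpret A: group "alt_group n" by (rule alt_group_is_group)
  let ?o = "\<lambda>cs. real (group.ord (alt_group n) (cycles_perm cs))"
  have x: "cycles_perm cx \<in> carrier (alt_group n)" and y: "cycles_perm cy \<in> carrier (alt_group n)"
    using cycles(1,2) cycles_perm_in_alt_group by auto
  have z: "cycles_perm cw \<in> carrier (alt_group n)"
    using A.m_closed[OF x y] unfolding alt_group_mult w .
  have d: "distinct (concat cx)" "distinct (concat cy)"
    using cycles(1,2) unfolding even_cycles_def by auto
  have "1 / ?o cx \<le> 1 / real (length a)" "1 / ?o cy \<le> 1 / real (length b)" "1 / ?o cw \<le> 1 / real (length c)"
    using length_le_ord_cycles_perm[OF d(1) x long(1)] length_le_ord_cycles_perm[OF d(2) y long(2)]
      length_le_ord_cycles_perm[OF cycles(3) z long(3)] long(4-6)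
    by (auto intro!: frac_le)
  then have "1 / ?o cx + 1 / ?o cy + 1 / ?o cw < 1" using long(7) by linarith
  moreover have "card_moved (cycles_perm cs ^^ j) \<in> M"
    if cs: "cs \<in> {cx, cy, cw}" and "cycles_perm cs ^^ j \<noteq> id" for cs j
  proof -
    have "distinct (concat cs)" using cs d cycles(3) by auto
    from card_moved_cycles_perm_funpow[OF this, of j]
    have "card_moved (cycles_perm cs ^^ j) \<in> insert 0 M" using M[OF cs, of j] by simp
    moreover have "card_moved (cycles_perm cs ^^ j) \<noteq> 0"
    proof
      assume "card_moved (cycles_perm cs ^^ j) = 0"
      then have "cycles_perm cs ^^ j = id"
        by (rule eq_id_if_card_moved_eq_0[OF permutes_funpow[OF cycles_perm_permutes] finite_set])
      then show False using that(2) by contradiction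
    qed
    ultimately show ?thesis by blast
  qed
  ultimately show ?thesis unfolding hyperbolic_pair_def w using x y gen by blast
qed

section \<open>Two cycles overlapping in an interval\<close>

text \<open>The sign \<open>s\<close> of the inverting permutation is recorded because combining two pairs requires their
signs to agree.\<close>

definition real_hyperbolic_pair :: "nat \<Rightarrow> nat set \<Rightarrow> int \<Rightarrow> bool"
  where "real_hyperbolic_pair n M s \<longleftrightarrow> (\<exists>x y t. hyperbolic_pair n M x y \<and> t permutes {1..n} \<and> sign t = s \<and>
    t \<circ> x \<circ> inv' t = inv' x \<and> t \<circ> y \<circ> inv' t = inv' y)"

lemma strongly_real_if_real_hyperbolic_pairs:
  assumes "real_hyperbolic_pair n M1 s" "real_hyperbolic_pair n M2 s" "M1 \<inter> M2 = {}"
  shows "strongly_real_beauville_group (alt_group n)"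
proof -
  obtain x1 y1 t1 where 1: "hyperbolic_pair n M1 x1 y1" "t1 permutes {1..n}" "sign t1 = s"
    "t1 \<circ> x1 \<circ> inv' t1 = inv' x1" "t1 \<circ> y1 \<circ> inv' t1 = inv' y1"
    using assms(1) unfolding real_hyperbolic_pair_def by blast
  obtain x2 y2 t2 where 2: "hyperbolic_pair n M2 x2 y2" "t2 permutes {1..n}" "sign t2 = s"
    "t2 \<circ> x2 \<circ> inv' t2 = inv' x2" "t2 \<circ> y2 \<circ> inv' t2 = inv' y2"
    using assms(2) unfolding real_hyperbolic_pair_def by blast
  show ?thesis
    by (rule strongly_real_alt_group_if_conj[OF 1(1) 2(1) assms(3) 1(2) 2(2) _ 1(4,5) 2(4,5)])
      (simp add: 1(3) 2(3))
qed

text \<open>Reversing a list swaps its first and last entries and reverses what lies between, hence the sign.\<close>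

lemma ex_reversal:
  "distinct xs \<Longrightarrow> \<exists>t. t permutes set xs \<and> map t xs = rev xs \<and> sign t = (- 1) ^ (length xs div 2)"
proof (induction xs rule: length_induct)
  case (1 xs)
  show ?case
  proof (cases "length xs \<le> 1")
    case True
    then consider "xs = []" | a where "xs = [a]" by (cases xs) auto
    then show ?thesis
      by cases (auto intro!: exI[of _ id] simp: permutes_id sign_id simp flip: id_def)
  next
    case False
    then obtain a zs where "xs = a # zs" "zs \<noteq> []" by (cases xs) auto
    then obtain ys b where xs: "xs = a # ys @ [b]" by (cases zs rule: rev_cases) auto
    have d: "distinct ys" "a \<noteq> b" "a \<notin> set ys" "b \<notin> set ys" using 1(2) unfolding xs by auto
    then obtain t where t: "t permutes set ys" "map t ys = rev ys" "sign t = (- 1) ^ (length ys div 2)"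
      using 1(1)[rule_format, of ys] unfolding xs by auto
    have fix_ab: "t a = a" "t b = b" using permutes_not_in[OF t(1)] d by auto
    have in_ys: "t i \<in> set ys" if "i \<in> set ys" for i using that permutes_in_image[OF t(1)] by simp
    let ?t = "transpose a b \<circ> t"
    have "transpose a b permutes set xs" unfolding xs by (rule permutes_swap_id) auto
    moreover have "t permutes set xs" by (rule permutes_subset[OF t(1)]) (auto simp: xs)
    ultimately have "?t permutes set xs" using permutes_compose by blast
    moreover have "map ?t ys = rev ys"
    proof -
      have "?t i = t i" if "i \<in> set ys" for i
        using in_ys[OF that] d by (auto intro!: transpose_apply_other)
      then have "map ?t ys = map t ys" by (intro map_cong) auto
      then show ?thesis using t(2) by (simp only:)
    qed
    then have "map ?t xs = rev xs" unfolding xs using fix_ab by simp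
    moreover have "sign ?t = (- 1) ^ (length xs div 2)"
    proof -
      have "permutation t" using t(1) permutation_permutes by blast
      then have "sign ?t = - ((- 1) ^ (length ys div 2))"
        using sign_compose[OF permutation_swap_id, of t a b] d(2) t(3) by (simp only: sign_swap_id if_False)
      then show ?thesis unfolding xs by simp
    qed
    ultimately show ?thesis by blast
  qed
qed

text \<open>Let \<open>q\<close> be the last entry of \<open>p # L\<close> and \<open>c\<close> the cycle on \<open>p # L\<close>. The first factor is \<open>c\<close> times the
cycle on \<open>q # A\<close>, the second is the inverse of \<open>c\<close> times the cycle on \<open>p # B\<close>. As \<open>c\<close> maps \<open>q\<close> to \<open>p\<close> and
fixes \<open>A\<close>, the product consists of the cycles on \<open>p # A\<close> and \<open>p # B\<close>, which share only \<open>p\<close>.\<close>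

lemma overlapping_cycles_comp:
  assumes "distinct ((p # L) @ A @ B)"
  shows "cycle_of_list ((p # L) @ A) \<circ> cycle_of_list (rev (p # L) @ B) = cycle_of_list (A @ p # B)"
proof -
  obtain M q where M: "p # L = M @ [q]" by (metis append_butlast_last_id list.distinct(1))
  let ?c = "cycle_of_list (p # L)"
  have "?c q = p"
  proof (cases M)
    case (Cons p' M')
    then have "p # L = p # M' @ [q]" using M by simp
    then show ?thesis using cycle_of_list_last[of p M' q] assms by (metis distinct_append)
  qed (use M in simp)
  moreover have "map ?c A = A" using assms by (intro map_idI id_outside_supp) auto
  ultimately have conj: "?c \<circ> cycle_of_list (q # A) \<circ> inv' ?c = cycle_of_list (p # A)"
    using conjugation_of_cycle[OF _ bij_cycle_of_list[of "p # L"], of "q # A"] assms M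
    by (metis distinct_append list.simps(9) append.assoc append_Cons append_Nil)
  have x: "cycle_of_list ((p # L) @ A) = ?c \<circ> cycle_of_list (q # A)"
    unfolding M using cycle_of_list_append[of M q A] by simp
  have y: "cycle_of_list (rev (p # L) @ B) = inv' ?c \<circ> cycle_of_list (p # B)"
    unfolding inv_cycle_of_list using cycle_of_list_append[of "rev L" p B] by simp
  have "cycle_of_list (p # A) = cycle_of_list (A @ [p])"
    using cycle_of_list_rotate[of "[p]" A] assms by simp
  then have "cycle_of_list (A @ p # B) = cycle_of_list (p # A) \<circ> cycle_of_list (p # B)"
    unfolding cycle_of_list_append[of A p B] by (simp only:)
  then show ?thesis unfolding x y conj[symmetric] by (simp only: comp_assoc)
qed

text \<open>The number of transpositions in the reflection that inverts two overlapping cycles of odd length.\<close>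

lemma halves_sum:
  fixes l a b :: nat
  assumes "odd (l + a)" "odd (l + b)"
  shows "l div 2 + a div 2 + b div 2 = (l + a + b - 1) div 2"
proof (cases "even l")
  case True
  then have "odd a" "odd b" using assms by auto
  with True show ?thesis by (elim evenE oddE) simp
next
  case False
  then have "even a" "even b" using assms by auto
  with False show ?thesis by (elim evenE oddE) simp
qed

lemma moved_count_single: "moved_count [c] j \<in> {0, length c}"
  by (simp add: moved_count_def)

lemma cycles_perm_single: "cycles_perm [c] = cycle_of_list c"
  by simp

text \<open>The cycles \<open>x\<close> on \<open>L @ A\<close> and \<open>y\<close> on \<open>rev L @ B\<close> and their product all consist of one nontrivial
cycle, so every nontrivial power moves exactly as many points as the cycle has. The three cycles
fix \<open>length B\<close>, \<open>length A\<close> and \<open>length L - 1\<close> points, which add up to \<open>n - 1\<close>. Reversing each of the three lists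
reflects both cycles and so inverts both. The parity conditions force the sign of this
reflection to depend on \<open>n\<close> alone, which is why any two such pairs of the same degree can be combined.\<close>

lemma real_hyperbolic_pair_overlapping:
  assumes d: "distinct (L @ A @ B)" and n: "set (L @ A @ B) = {1..n}" and L: "L \<noteq> []"
    and odd: "odd (length L + length A)" "odd (length L + length B)"
    and gen: "generate (alt_group n) {cycle_of_list (L @ A), cycle_of_list (rev L @ B)} = carrier (alt_group n)"
    and hyp: "1 / real (length L + length A) + 1 / real (length L + length B)
      + 1 / real (length A + length B + 1) < 1"
  shows "real_hyperbolic_pair n {length L + length A, length L + length B, length A + length B + 1}
    ((- 1) ^ ((n - 1) div 2))"
proof -
  let ?x = "cycle_of_list (L @ A)" and ?y = "cycle_of_list (rev L @ B)"
  obtain p L' where p: "L = p # L'" using L by (cases L) auto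
  have "hyperbolic_pair n {length L + length A, length L + length B, length A + length B + 1}
    (cycles_perm [L @ A]) (cycles_perm [rev L @ B])"
  proof (rule hyperbolic_pairI[where a = "L @ A" and b = "rev L @ B" and cw = "[A @ p # B]" and c = "A @ p # B"])
    show "even_cycles n [L @ A]" "even_cycles n [rev L @ B]"
      using d n odd L unfolding even_cycles_def by (auto simp: even_diff_nat)
    show "distinct (concat [A @ p # B])" using d p by auto
    show "cycles_perm [L @ A] \<circ> cycles_perm [rev L @ B] = cycles_perm [A @ p # B]"
      unfolding cycles_perm_single p by (rule overlapping_cycles_comp) (use d p in simp)
    show "generate (alt_group n) {cycles_perm [L @ A], cycles_perm [rev L @ B]} = carrier (alt_group n)"
      unfolding cycles_perm_single by (rule gen)
    show "moved_count cs j \<in> insert 0 {length L + length A, length L + length B, length A + length B + 1}"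
      if "cs \<in> {[L @ A], [rev L @ B], [A @ p # B]}" for cs j
      using that moved_count_single[of "L @ A" j] moved_count_single[of "rev L @ B" j]
        moved_count_single[of "A @ p # B" j] by auto
    have "length (A @ p # B) = length A + length B + 1" by simp
    then show "1 / real (length (L @ A)) + 1 / real (length (rev L @ B)) + 1 / real (length (A @ p # B)) < 1"
      unfolding length_append length_rev using hyp by (simp only:)
  qed (use L in \<open>auto simp: Suc_le_eq\<close>)
  then have pair: "hyperbolic_pair n {length L + length A, length L + length B, length A + length B + 1} ?x ?y"
    unfolding cycles_perm_single .
  have dd: "distinct L" "distinct A" "distinct B" using d by auto
  obtain tL where tL: "tL permutes set L" "map tL L = rev L" "sign tL = (- 1) ^ (length L div 2)"
    using ex_reversal[OF dd(1)] by blast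
  obtain tA where tA: "tA permutes set A" "map tA A = rev A" "sign tA = (- 1) ^ (length A div 2)"
    using ex_reversal[OF dd(2)] by blast
  obtain tB where tB: "tB permutes set B" "map tB B = rev B" "sign tB = (- 1) ^ (length B div 2)"
    using ex_reversal[OF dd(3)] by blast
  define t where "t = tL \<circ> tA \<circ> tB"
  have "tL permutes {1..n}" "tA permutes {1..n}" "tB permutes {1..n}"
    using permutes_subset[OF tL(1), of "{1..n}"] permutes_subset[OF tA(1), of "{1..n}"]
      permutes_subset[OF tB(1), of "{1..n}"] unfolding n[symmetric] by auto
  then have t_perm: "t permutes {1..n}" unfolding t_def using permutes_compose by blast
  have perms: "permutation tL" "permutation tA" "permutation tB"
    using tL(1) tA(1) tB(1) permutation_permutes by blast+
  have "sign t = (- 1) ^ (length L div 2 + length A div 2 + length B div 2)"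
    unfolding t_def using perms tL(3) tA(3) tB(3)
    by (simp only: sign_compose permutation_compose power_add)
  moreover have "length L div 2 + length A div 2 + length B div 2 = (n - 1) div 2"
  proof -
    have "n = card (set (L @ A @ B))" unfolding n by simp
    then have "n = length L + length A + length B" unfolding distinct_card[OF d] by simp
    then show ?thesis using halves_sum[OF odd] by simp
  qed
  ultimately have sign: "sign t = (- 1) ^ ((n - 1) div 2)" by simp
  have fixesL: "tL i = i" if "i \<notin> set L" for i using permutes_not_in[OF tL(1) that] .
  have fixesA: "tA i = i" if "i \<notin> set A" for i using permutes_not_in[OF tA(1) that] .
  have fixesB: "tB i = i" if "i \<notin> set B" for i using permutes_not_in[OF tB(1) that] .
  have "map t L = map tL L" "map t A = map tA A" "map t B = map tB B"
  proof -
    have disj: "set L \<inter> set A = {}" "set L \<inter> set B = {}" "set A \<inter> set B = {}" using d by auto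
    have "t i = tL i" if i: "i \<in> set L" for i
    proof -
      have "i \<notin> set A" "i \<notin> set B" using i disj by blast+
      then show ?thesis unfolding t_def by (simp add: fixesA fixesB)
    qed
    moreover have "t i = tA i" if i: "i \<in> set A" for i
    proof -
      have "i \<notin> set B" "tA i \<notin> set L" using i disj permutes_in_image[OF tA(1), of i] by blast+
      then show ?thesis unfolding t_def by (simp add: fixesL fixesB)
    qed
    moreover have "t i = tB i" if i: "i \<in> set B" for i
    proof -
      have "tB i \<notin> set A" "tB i \<notin> set L" using i disj permutes_in_image[OF tB(1), of i] by blast+
      then show ?thesis unfolding t_def by (simp add: fixesL fixesA)
    qed
    ultimately show "map t L = map tL L" "map t A = map tA A" "map t B = map tB B"
      by (auto simp del: set_map intro!: map_cong)
  qed
  then have maps: "map t L = rev L" "map t A = rev A" "map t B = rev B"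
    using tL(2) tA(2) tB(2) by auto
  have dLA: "distinct (L @ A)" and dLB: "distinct (rev L @ B)" using d by auto
  have "t \<circ> ?x \<circ> inv' t = cycle_of_list (rev L @ rev A)"
    using conjugation_of_cycle[OF dLA permutes_bij[OF t_perm]] unfolding map_append maps .
  also have "\<dots> = inv' ?x"
    unfolding inv_cycle_of_list using cycle_of_list_rotate[of "rev L" "rev A"] dLA by simp
  finally have x: "t \<circ> ?x \<circ> inv' t = inv' ?x" .
  have rev_L: "map t (rev L) = L" unfolding rev_map[symmetric] maps(1) by simp
  have "t \<circ> ?y \<circ> inv' t = cycle_of_list (L @ rev B)"
    using conjugation_of_cycle[OF dLB permutes_bij[OF t_perm]] unfolding map_append maps rev_L .
  also have "\<dots> = inv' ?y"
    unfolding inv_cycle_of_list using cycle_of_list_rotate[of "L" "rev B"] dLB by simp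
  finally have y: "t \<circ> ?y \<circ> inv' t = inv' ?y" .
  show ?thesis unfolding real_hyperbolic_pair_def using pair t_perm sign x y by blast
qed

section \<open>Generation of the alternating group by overlapping cycles\<close>

text \<open>Cycles on symbolic lists are kept folded; unfolded into transpositions they hide which list they come from.\<close>

declare cycle_of_list.simps(1) [simp del]

lemma cycle_subset_if_closed:
  assumes "distinct c" "a \<in> set c" "a \<in> S" "\<And>i. i \<in> S \<Longrightarrow> i \<in> set c \<Longrightarrow> cycle_of_list c i \<in> S"
  shows "set c \<subseteq> S"
proof -
  have in_c: "(cycle_of_list c ^^ j) a \<in> S \<and> (cycle_of_list c ^^ j) a \<in> set c" for j
    by (induction j) (use assms permutes_in_image[OF cycle_permutes[of c]] in auto)
  obtain i where i: "i < length c" "c ! i = a" using assms(2) by (auto simp: in_set_conv_nth)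
  have "c ! k \<in> S" if "k < length c" for k
  proof -
    have "(k + length c - i + i) mod length c = k" using i(1) that by simp
    then have "(cycle_of_list c ^^ (k + length c - i)) a = c ! k"
      using cycle_of_list_funpow_nth[OF assms(1) i(1), of "k + length c - i"] i(2) by simp
    then show ?thesis using in_c by metis
  qed
  then show ?thesis by (auto simp: in_set_conv_nth)
qed

text \<open>A cycle of odd length is a power of its square.\<close>

lemma subset_if_closed_square:
  assumes "distinct c" "odd (length c)" "\<And>i. i \<in> S \<Longrightarrow> (cycle_of_list c ^^ 2) i \<in> S" "i \<in> S"
  shows "cycle_of_list c i \<in> S"
proof -
  let ?x = "cycle_of_list c"
  obtain m where m: "length c + 1 = 2 * m" using assms(2) by (metis even_Suc evenE Suc_eq_plus1)
  have "((?x ^^ 2) ^^ k) i \<in> S" for k by (induction k) (use assms(3,4) in auto)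
  then have "(?x ^^ (length c + 1)) i \<in> S" unfolding m by (metis funpow_mult)
  then show ?thesis using cycle_is_id_root[OF assms(1)] by simp
qed

lemma generate_subgroup:
  assumes "x \<in> carrier (alt_group n)" "y \<in> carrier (alt_group n)"
  shows "subgroup (generate (alt_group n) {x, y}) (alt_group n)"
    "x \<in> generate (alt_group n) {x, y}" "y \<in> generate (alt_group n) {x, y}"
  using group.generate_is_subgroup[OF alt_group_is_group, of "{x, y}" n] assms
  by (auto intro: generate.incl)

lemma overlapping_in_alt_group:
  assumes "distinct (L @ A)" "set (L @ A) \<subseteq> {1..n}" "odd (length L + length A)"
  shows "cycle_of_list (L @ A) \<in> carrier (alt_group n)"
  using cycles_perm_in_alt_group[of n "[L @ A]"] assms unfolding even_cycles_def cycles_perm_single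
  by (auto simp: even_diff_nat)

lemma distinct_overlapping:
  assumes "distinct (L @ A @ B)" "set (L @ A @ B) \<subseteq> U"
  shows "distinct (L @ A)" "distinct (rev L @ B)" "set (L @ A) \<subseteq> U" "set (rev L @ B) \<subseteq> U"
  using assms by auto

lemma cycle_of_list_succ_eq:
  "distinct c \<Longrightarrow> c = xs @ i # j # ys \<Longrightarrow> cycle_of_list c i = j"
  using cycle_of_list_succ by simp

text \<open>By \<open>overlapping_cycles_comp\<close> the product of the two cycles is itself a 3-cycle.\<close>

lemma generate_overlapping_1_1:
  assumes d: "distinct ((p # L) @ [a] @ [b])" and n: "set ((p # L) @ [a] @ [b]) = {1..n}"
    and odd: "odd (length (p # L) + 1)"
  shows "generate (alt_group n) {cycle_of_list ((p # L) @ [a]), cycle_of_list (rev (p # L) @ [b])}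
    = carrier (alt_group n)" (is "generate _ {?x, ?y} = _")
proof -
  have "?x \<in> carrier (alt_group n)" "?y \<in> carrier (alt_group n)"
    by (rule overlapping_in_alt_group; use d n odd in auto)+
  note H = generate_subgroup[OF this]
  have "?x \<circ> ?y = cycle_of_list [a, p, b]" using overlapping_cycles_comp[OF d] by simp
  then have three: "cycle_of_list [a, p, b] \<in> generate (alt_group n) {?x, ?y}"
    using comp_closed[OF H] by metis
  have xa: "?x a = p" using cycle_of_list_last[of p L a] d by simp
  have yp: "?y p = b" using cycle_of_list_succ[of "rev L" p b "[]"] d by simp
  show ?thesis
  proof (rule eq_alt_group_if_three_cycle[OF H(1) three, where K = "{?x, ?y}"])
    show "\<exists>i \<in> {a, p, b}. g i \<in> {a, p, b}" if "g \<in> {?x, ?y}" for g using that xa yp by blast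
    fix S assume S: "a \<in> S" "\<And>g i. g \<in> {?x, ?y} \<Longrightarrow> i \<in> S \<Longrightarrow> g i \<in> S"
    have "set ((p # L) @ [a]) \<subseteq> S" by (rule cycle_subset_if_closed[of _ a]) (use d S in auto)
    moreover have "b \<in> S" using S(2)[of ?y p] yp calculation by simp
    ultimately show "{1..n} \<subseteq> S" using n by auto
  qed (use d H in auto)
qed

text \<open>Again the product of the two cycles is a 3-cycle; the second factor fixes its point \<open>a\<close>.\<close>

lemma generate_overlapping_2_0:
  assumes d: "distinct ((p # L) @ [a, b] @ [])" and n: "set ((p # L) @ [a, b] @ []) = {1..n}"
    and odd: "odd (length (p # L))"
  shows "generate (alt_group n) {cycle_of_list ((p # L) @ [a, b]), cycle_of_list (rev (p # L) @ [])}
    = carrier (alt_group n)" (is "generate _ {?x, ?y} = _")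
proof -
  have "?x \<in> carrier (alt_group n)" "?y \<in> carrier (alt_group n)"
    by (rule overlapping_in_alt_group; use d n odd in auto)+
  note H = generate_subgroup[OF this]
  have "?x \<circ> ?y = cycle_of_list [a, b, p]" using overlapping_cycles_comp[OF d] by simp
  then have three: "cycle_of_list [a, b, p] \<in> generate (alt_group n) {?x, ?y}"
    using comp_closed[OF H] by metis
  have xa: "?x a = b" using cycle_of_list_succ[of "p # L" a b "[]"] d by simp
  have ya: "?y a = a" by (rule id_outside_supp) (use d in auto)
  show ?thesis
  proof (rule eq_alt_group_if_three_cycle[OF H(1) three, where K = "{?x, ?y}"])
    show "\<exists>i \<in> {a, b, p}. g i \<in> {a, b, p}" if "g \<in> {?x, ?y}" for g using that xa ya by blast
    fix S assume S: "a \<in> S" "\<And>g i. g \<in> {?x, ?y} \<Longrightarrow> i \<in> S \<Longrightarrow> g i \<in> S"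
    have "set ((p # L) @ [a, b]) \<subseteq> S" by (rule cycle_subset_if_closed[of _ a]) (use d S in auto)
    then show "{1..n} \<subseteq> S" using n by auto
  qed (use d H in auto)
qed

text \<open>The transpositions \<open>(p b)\<close> and \<open>(r b)\<close> share a point and compose to a 3-cycle; the other two are
disjoint from everything else and disappear on squaring.\<close>

lemma square_of_overlapping_transpositions:
  assumes "distinct [p, b, r, q, a1, a2, a3]"
  shows "(cycles_perm [[p, b], [q, a1]] \<circ> cycles_perm [[r, b], [a2, a3]])
    \<circ> (cycles_perm [[p, b], [q, a1]] \<circ> cycles_perm [[r, b], [a2, a3]]) = cycle_of_list [b, p, r]"
    (is "?l = ?r")
proof
  fix i
  consider "i = p" | "i = b" | "i = r" | "i = q" | "i = a1" | "i = a2" | "i = a3"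
    | "i \<notin> {p, b, r, q, a1, a2, a3}" by blast
  moreover have "distinct (rev [p, b, r, q, a1, a2, a3])" using assms by (simp only: distinct_rev)
  ultimately show "?l i = ?r i"
    by cases (use assms in \<open>simp_all add: transpose_def cycle_of_list.simps(1)\<close>)
qed

text \<open>A 3-cycle is obtained as follows. With \<open>E\<close> the cycle on \<open>B @ A\<close> the products are \<open>x y = (p b) E\<close> and
\<open>y x = (q a1) E\<close>, so \<open>(x y) (y x)^-1 = (p b) (q a1)\<close>, of which the conjugate by the square of \<open>x\<close> is
\<open>(r b) (a2 a3)\<close>. The square of the product of these two is the 3-cycle \<open>(b p r)\<close>.
The square of \<open>x\<close> maps \<open>p\<close> to \<open>r\<close> and \<open>y\<close> maps \<open>p\<close> to \<open>b\<close>, and the two act transitively because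
the length of \<open>x\<close> is odd.\<close>

lemma generate_overlapping_long:
  assumes d: "distinct ((p # p' # r # L @ [q]) @ (a1 # a2 # a3 # A) @ (b # B))"
    and n: "set ((p # p' # r # L @ [q]) @ (a1 # a2 # a3 # A) @ (b # B)) = {1..n}"
    and odd: "odd (length (p # p' # r # L @ [q]) + length (a1 # a2 # a3 # A))"
      "odd (length (p # p' # r # L @ [q]) + length (b # B))"
  shows "generate (alt_group n) {cycle_of_list ((p # p' # r # L @ [q]) @ (a1 # a2 # a3 # A)),
      cycle_of_list (rev (p # p' # r # L @ [q]) @ (b # B))} = carrier (alt_group n)"
    (is "generate _ {?x, ?y} = _")
proof -
  let ?L = "p # p' # r # L @ [q]" and ?A = "a1 # a2 # a3 # A" and ?B = "b # B"
  let ?H = "generate (alt_group n) {?x, ?y}"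
  note dist = distinct_overlapping[OF d eq_refl[OF n]]
  have "?x \<in> carrier (alt_group n)"
    by (rule overlapping_in_alt_group[OF dist(1,3) odd(1)])
  moreover have "?y \<in> carrier (alt_group n)"
    by (rule overlapping_in_alt_group[OF dist(2,4)]) (use odd(2) in simp)
  ultimately have "?x \<in> carrier (alt_group n)" "?y \<in> carrier (alt_group n)" .
  note H = generate_subgroup[OF this]
  let ?E = "cycle_of_list (?B @ ?A)"
  have "?x \<circ> ?y = cycle_of_list (?A @ p # ?B)" using overlapping_cycles_comp[OF d] .
  also have "\<dots> = cycle_of_list ((p # ?B) @ ?A)" by (rule cycle_of_list_rotate) (use d in auto)
  also have "\<dots> = transpose p b \<circ> ?E" by (simp only: append.simps cycle_of_list.simps)
  finally have u: "?x \<circ> ?y = transpose p b \<circ> ?E" .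
  have "distinct ((q # rev (p # p' # r # L)) @ ?B @ ?A)" using d by auto
  from overlapping_cycles_comp[OF this] have "?y \<circ> ?x = cycle_of_list (?B @ q # ?A)" by simp
  also have "\<dots> = cycle_of_list ((q # ?A) @ ?B)" by (rule cycle_of_list_rotate) (use d in auto)
  also have "\<dots> = transpose q a1 \<circ> cycle_of_list (?A @ ?B)"
    by (simp only: append.simps cycle_of_list.simps)
  also have "cycle_of_list (?A @ ?B) = ?E" by (rule cycle_of_list_rotate) (use d in auto)
  finally have v: "?y \<circ> ?x = transpose q a1 \<circ> ?E" .
  let ?cs = "[[p, b], [q, a1]]"
  have "inv' (transpose q a1 \<circ> ?E) = inv' ?E \<circ> transpose q a1"
    using o_inv_distrib[OF _ bij_cycle_of_list, of "transpose q a1" "?B @ ?A"] by simp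
  then have "(?x \<circ> ?y) \<circ> inv' (?y \<circ> ?x) = transpose p b \<circ> (?E \<circ> inv' ?E) \<circ> transpose q a1"
    unfolding u v by (simp only: comp_assoc)
  also have "?E \<circ> inv' ?E = id" using bij_cycle_of_list[of "?B @ ?A"] by (simp only: bij_is_surj flip: surj_iff)
  also have "transpose p b \<circ> id \<circ> transpose q a1 = cycles_perm ?cs" by (simp add: cycle_of_list.simps(1))
  finally have dd: "(?x \<circ> ?y) \<circ> inv' (?y \<circ> ?x) = cycles_perm ?cs" .
  have D: "cycles_perm ?cs \<in> ?H"
    unfolding dd[symmetric] using H comp_closed[OF H(1)] inv_closed[OF H(1)] by blast
  let ?x2 = "?x ^^ 2"
  have x2: "?x2 \<in> ?H" using H comp_closed[OF H(1)] by (simp add: numeral_2_eq_2)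
  have succ: "?x p = p'" "?x p' = r" "?x q = a1" "?x a1 = a2" "?x a2 = a3"
    by (rule cycle_of_list_succ_eq[OF dist(1), of "[]" p p' "r # L @ q # ?A"], simp)
      (rule cycle_of_list_succ_eq[OF dist(1), of "[p]" p' r "L @ q # ?A"], simp,
       rule cycle_of_list_succ_eq[OF dist(1), of "p # p' # r # L" q a1 "a2 # a3 # A"], simp,
       rule cycle_of_list_succ_eq[OF dist(1), of "?L" a1 a2 "a3 # A"], simp,
       rule cycle_of_list_succ_eq[OF dist(1), of "?L @ [a1]" a2 a3 "A"], simp)
  have xb: "?x b = b" by (rule id_outside_supp) (use d in auto)
  have x2s: "?x2 p = r" "?x2 q = a2" "?x2 a1 = a3" "?x2 b = b"
    using succ xb by (simp_all add: numeral_2_eq_2)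
  have "?x2 \<circ> cycles_perm ?cs \<circ> inv' ?x2 = cycles_perm (map (map ?x2) ?cs)"
    by (rule conj_cycles_perm) (use bij_mem[OF H(1) x2] d in auto)
  also have "map (map ?x2) ?cs = [[r, b], [a2, a3]]" using x2s by (simp)
  finally have "cycles_perm [[r, b], [a2, a3]] \<in> ?H"
    using comp_closed[OF H(1) comp_closed[OF H(1) x2 D] inv_closed[OF H(1) x2]] by (simp only:)
  from comp_closed[OF H(1) D this]
  have e: "cycles_perm ?cs \<circ> cycles_perm [[r, b], [a2, a3]] \<in> ?H" .
  have "(cycles_perm ?cs \<circ> cycles_perm [[r, b], [a2, a3]]) \<circ> (cycles_perm ?cs \<circ> cycles_perm [[r, b], [a2, a3]])
    = cycle_of_list [b, p, r]"
    by (rule square_of_overlapping_transpositions) (use d in auto)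
  then have three: "cycle_of_list [b, p, r] \<in> ?H" using comp_closed[OF H(1) e e] by (simp only:)
  have yp: "?y p = b"
    by (rule cycle_of_list_succ_eq[OF dist(2), of "rev (p' # r # L @ [q])" p b B]) simp
  show ?thesis
  proof (rule eq_alt_group_if_three_cycle[OF H(1) three, where K = "{?x2, ?y}"])
    show "\<exists>i \<in> {b, p, r}. g i \<in> {b, p, r}" if "g \<in> {?x2, ?y}" for g using that x2s(1) yp by blast
    fix S assume S: "b \<in> S" "\<And>g i. g \<in> {?x2, ?y} \<Longrightarrow> i \<in> S \<Longrightarrow> g i \<in> S"
    have y: "set (rev ?L @ ?B) \<subseteq> S"
      by (rule cycle_subset_if_closed[OF dist(2), of b]) (use S in auto)
    have "set (?L @ ?A) \<subseteq> S"
    proof (rule cycle_subset_if_closed[OF dist(1), of p])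
      show "p \<in> S" using y by auto
      show "?x i \<in> S" if "i \<in> S" for i
        by (rule subset_if_closed_square[OF dist(1) _ _ that]) (use odd S(2)[of ?x2] in auto)
    qed auto
    then show "{1..n} \<subseteq> S" using y unfolding n[symmetric] by simp
  qed (use d H x2 in auto)
qed

section \<open>The four families of pairs\<close>

lemma hyperbolic_sum:
  fixes l m r :: nat
  assumes "4 \<le> l" "4 \<le> m" "3 \<le> r"
  shows "1 / real l + 1 / real m + 1 / real r < 1"
proof -
  have "1 / real l \<le> 1 / 4" "1 / real m \<le> 1 / 4" "1 / real r \<le> 1 / 3"
    using assms by (auto intro!: divide_left_mono)
  then show ?thesis by linarith
qed

lemma real_hyperbolic_pair_even_three_cycle:
  assumes "even n" "n \<ge> 8"
  shows "real_hyperbolic_pair n {n - 1, 3} ((- 1) ^ ((n - 1) div 2))"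
proof -
  let ?L = "1 # [2..<n - 1]" and ?A = "[n - 1]" and ?B = "[n]"
  have len: "length ?L = n - 2" using assms by simp
  have d: "distinct (?L @ ?A @ ?B)" using assms by auto
  have s: "set (?L @ ?A @ ?B) = {1..n}" using assms by auto
  have "real_hyperbolic_pair n {length ?L + length ?A, length ?L + length ?B, length ?A + length ?B + 1}
    ((- 1) ^ ((n - 1) div 2))"
  proof (rule real_hyperbolic_pair_overlapping[OF d s])
    show "generate (alt_group n) {cycle_of_list (?L @ ?A), cycle_of_list (rev ?L @ ?B)} = carrier (alt_group n)"
      by (rule generate_overlapping_1_1[OF d s]) (use assms len in simp)
    show "1 / real (length ?L + length ?A) + 1 / real (length ?L + length ?B)
      + 1 / real (length ?A + length ?B + 1) < 1"
      by (rule hyperbolic_sum; use assms in simp)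
  qed (use assms len in simp_all)
  moreover have "{length ?L + length ?A, length ?L + length ?B, length ?A + length ?B + 1} = {n - 1, 3}"
    unfolding len using assms by auto
  ultimately show ?thesis by simp
qed

lemma real_hyperbolic_pair_odd_three_cycle:
  assumes "odd n" "n \<ge> 9"
  shows "real_hyperbolic_pair n {n, n - 2, 3} ((- 1) ^ ((n - 1) div 2))"
proof -
  let ?L = "1 # [2..<n - 1]" and ?A = "[n - 1, n]" and ?B = "[] :: nat list"
  have len: "length ?L = n - 2" using assms by simp
  have d: "distinct (?L @ ?A @ ?B)" using assms by auto
  have s: "set (?L @ ?A @ ?B) = {1..n}" using assms by auto
  have "real_hyperbolic_pair n {length ?L + length ?A, length ?L + length ?B, length ?A + length ?B + 1}
    ((- 1) ^ ((n - 1) div 2))"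
  proof (rule real_hyperbolic_pair_overlapping[OF d s])
    show "generate (alt_group n) {cycle_of_list (?L @ ?A), cycle_of_list (rev ?L @ ?B)} = carrier (alt_group n)"
      by (rule generate_overlapping_2_0[OF d s]) (use assms len in simp)
    show "1 / real (length ?L + length ?A) + 1 / real (length ?L + length ?B)
      + 1 / real (length ?A + length ?B + 1) < 1"
      by (rule hyperbolic_sum; use assms in simp)
  qed (use assms len in simp_all)
  moreover have "{length ?L + length ?A, length ?L + length ?B, length ?A + length ?B + 1} = {n, n - 2, 3}"
    unfolding len using assms by auto
  ultimately show ?thesis by simp
qed

text \<open>Lengths 4 and 3 for \<open>L\<close> and \<open>A\<close> are the smallest that \<open>generate_overlapping_long\<close> allows. For odd \<open>n\<close>, where
\<open>A\<close> and \<open>B\<close> must have even length, they become 5 and 4.\<close>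

lemma real_hyperbolic_pair_even_seven_cycle:
  assumes "even n" "n \<ge> 10"
  shows "real_hyperbolic_pair n {7, n - 3} ((- 1) ^ ((n - 1) div 2))"
proof -
  let ?L = "1 # 2 # 3 # [] @ [4 :: nat]" and ?A = "5 # 6 # 7 # [] :: nat list" and ?B = "8 # [9..<n + 1]"
  have len: "length ?B = n - 7" using assms by simp
  have d: "distinct (?L @ ?A @ ?B)" using assms by auto
  have s: "set (?L @ ?A @ ?B) = {1..n}" using assms by auto
  have odd: "odd (length ?L + length ?A)" "odd (length ?L + length ?B)"
    unfolding len using assms by simp_all
  have "real_hyperbolic_pair n {length ?L + length ?A, length ?L + length ?B, length ?A + length ?B + 1}
    ((- 1) ^ ((n - 1) div 2))"
  proof (rule real_hyperbolic_pair_overlapping[OF d s _ odd])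
    show "generate (alt_group n) {cycle_of_list (?L @ ?A), cycle_of_list (rev ?L @ ?B)} = carrier (alt_group n)"
      by (rule generate_overlapping_long[OF d s odd])
    show "1 / real (length ?L + length ?A) + 1 / real (length ?L + length ?B)
      + 1 / real (length ?A + length ?B + 1) < 1"
      by (rule hyperbolic_sum; use assms in simp)
  qed simp
  moreover have "{length ?L + length ?A, length ?L + length ?B, length ?A + length ?B + 1} = {7, n - 3}"
    unfolding len using assms by auto
  ultimately show ?thesis by simp
qed

lemma real_hyperbolic_pair_odd_nine_cycle:
  assumes "odd n" "n \<ge> 13"
  shows "real_hyperbolic_pair n {9, n - 4} ((- 1) ^ ((n - 1) div 2))"
proof -
  let ?L = "1 # 2 # 3 # [4] @ [5 :: nat]" and ?A = "6 # 7 # 8 # [9 :: nat]" and ?B = "10 # [11..<n + 1]"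
  have len: "length ?B = n - 9" using assms by simp
  have d: "distinct (?L @ ?A @ ?B)" using assms by auto
  have s: "set (?L @ ?A @ ?B) = {1..n}" using assms(2) by (auto; presburger)
  have odd: "odd (length ?L + length ?A)" "odd (length ?L + length ?B)"
    unfolding len using assms by simp_all
  have "real_hyperbolic_pair n {length ?L + length ?A, length ?L + length ?B, length ?A + length ?B + 1}
    ((- 1) ^ ((n - 1) div 2))"
  proof (rule real_hyperbolic_pair_overlapping[OF d s _ odd])
    show "generate (alt_group n) {cycle_of_list (?L @ ?A), cycle_of_list (rev ?L @ ?B)} = carrier (alt_group n)"
      by (rule generate_overlapping_long[OF d s odd])
    show "1 / real (length ?L + length ?A) + 1 / real (length ?L + length ?B)
      + 1 / real (length ?A + length ?B + 1) < 1"
      by (rule hyperbolic_sum; use assms in simp)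
  qed simp
  moreover have "{length ?L + length ?A, length ?L + length ?B, length ?A + length ?B + 1} = {9, n - 4}"
    unfolding len using assms by auto
  ultimately show ?thesis by simp
qed

section \<open>Explicit pairs in degrees six to eleven\<close>

lemma permutes_eqI:
  assumes "p permutes {1..n}" "q permutes {1..n}" "map p [1..<Suc n] = map q [1..<Suc n]"
  shows "p = q"
proof
  fix i show "p i = q i"
  proof (cases "i \<in> {1..n}")
    case True
    then have "i \<in> set [1..<Suc n]" by (simp only: set_upt atLeastLessThanSuc_atLeastAtMost)
    then show ?thesis using assms(3) unfolding map_eq_conv by blast
  next
    case False
    then show ?thesis using permutes_not_in[OF assms(1) False] permutes_not_in[OF assms(2) False] by simp
  qed
qed

lemma cycles_perm_permutes_interval:
  "set (concat cs) \<subseteq> {1..n} \<Longrightarrow> cycles_perm cs permutes {1..n}"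
  by (rule permutes_subset[OF cycles_perm_permutes])

lemma cycles_perm_closed_set:
  assumes "distinct (concat cs)" "c \<in> set cs" "a \<in> set c" "a \<in> S" "\<And>i. i \<in> S \<Longrightarrow> cycles_perm cs i \<in> S"
  shows "set c \<subseteq> S"
proof (rule cycle_subset_if_closed)
  have "cycles_perm cs i = cycle_of_list c i" if "i \<in> set c" for i
    using assms(1,2) that
  proof (induction cs)
    case (Cons c' cs)
    show ?case
    proof (cases "c = c'")
      case True
      then have "i \<notin> set (concat cs)" using Cons.prems by auto
      then show ?thesis using True permutes_not_in[OF cycles_perm_permutes[of cs]] by simp
    next
      case False
      then have "c \<in> set cs" using Cons.prems by simp
      moreover have "cycle_of_list c i \<in> set c"
        using permutes_in_image[OF cycle_permutes[of c], of i] Cons.prems(3) by simp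
      ultimately have "cycle_of_list c i \<notin> set c'" using Cons.prems by auto
      then show ?thesis using Cons \<open>c \<in> set cs\<close> by (simp add: id_outside_supp)
    qed
  qed simp
  then show "cycle_of_list c i \<in> S" if "i \<in> S" "i \<in> set c" for i using assms(5)[OF that(1)] that(2) by simp
  show "distinct c" using assms(1,2) by (auto simp: distinct_concat_iff)
qed (use assms in auto)

text \<open>In what follows \<open>ns\<close> is the explicit list of all points. Equality of permutations is stated as equality
of their lists of values, because rewriting evaluates a product of transpositions quickly at a numeral
but splits into exponentially many cases at a bound variable.\<close>

lemma hyperbolic_pair_if_cycles:
  assumes ns: "[1..<Suc n] = ns"
    and cycles: "even_cycles n cx" "even_cycles n cy" "distinct (concat cw)" "set (concat cw) \<subseteq> {1..n}"
    and w: "map (cycles_perm cx) (map (cycles_perm cy) ns) = map (cycles_perm cw) ns"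
    and gen: "generate (alt_group n) {cycles_perm cx, cycles_perm cy} = carrier (alt_group n)"
    and long: "a \<in> set cx" "b \<in> set cy" "c \<in> set cw" "length a \<ge> 1" "length b \<ge> 1" "length c \<ge> 1"
      "1 / real (length a) + 1 / real (length b) + 1 / real (length c) < 1"
    and M: "\<And>cs j. cs \<in> {cx, cy, cw} \<Longrightarrow> moved_count cs j \<in> insert 0 M"
  shows "hyperbolic_pair n M (cycles_perm cx) (cycles_perm cy)"
proof -
  have perms: "cycles_perm cx permutes {1..n}" "cycles_perm cy permutes {1..n}" "cycles_perm cw permutes {1..n}"
    using cycles unfolding even_cycles_def by (blast intro: cycles_perm_permutes_interval)+
  have "cycles_perm cx \<circ> cycles_perm cy = cycles_perm cw"
    by (rule permutes_eqI[OF permutes_compose[OF perms(2,1)] perms(3)]) (use w in \<open>simp only: map_map ns\<close>)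
  then show ?thesis using hyperbolic_pairI[OF cycles(1,2,3) _ gen long M] by blast
qed

text \<open>The checked equation \<open>x t x = t\<close> says that \<open>t\<close> conjugates \<open>x\<close> to its inverse and does not mention inverses.\<close>

lemma real_hyperbolic_pair_if_cycles:
  assumes ns: "[1..<Suc n] = ns"
    and pair: "hyperbolic_pair n M (cycles_perm cx) (cycles_perm cy)"
    and ct: "distinct (concat ct)" "set (concat ct) \<subseteq> {1..n}"
    and t: "map (cycles_perm cx) (map (cycles_perm ct) (map (cycles_perm cx) ns)) = map (cycles_perm ct) ns"
      "map (cycles_perm cy) (map (cycles_perm ct) (map (cycles_perm cy) ns)) = map (cycles_perm ct) ns"
    and s: "s = (- 1) ^ (\<Sum>c\<leftarrow>ct. length c - 1)"
  shows "real_hyperbolic_pair n M s"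
proof -
  let ?t = "cycles_perm ct"
  have perms: "cycles_perm cx permutes {1..n}" "cycles_perm cy permutes {1..n}"
    using pair unfolding hyperbolic_pair_def alt_group_carrier by blast+
  have t_perm: "?t permutes {1..n}" using ct(2) by (rule cycles_perm_permutes_interval)
  have inverts: "?t \<circ> x \<circ> inv' ?t = inv' x"
    if x: "x permutes {1..n}" and eq: "map x (map ?t (map x ns)) = map ?t ns" for x
  proof -
    have "x \<circ> (?t \<circ> x) = ?t"
      by (rule permutes_eqI[OF permutes_compose[OF permutes_compose[OF x t_perm] x] t_perm])
        (use eq in \<open>simp only: map_map ns\<close>)
    then have "inv' x \<circ> ?t = inv' x \<circ> x \<circ> (?t \<circ> x)" by (simp only: comp_assoc)
    also have "\<dots> = ?t \<circ> x" using permutes_inv_o(2)[OF x] by (simp only: id_comp)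
    finally have "?t \<circ> x \<circ> inv' ?t = (inv' x \<circ> ?t) \<circ> inv' ?t" by (simp only:)
    also have "\<dots> = inv' x \<circ> (?t \<circ> inv' ?t)" by (simp only: comp_assoc)
    also have "\<dots> = inv' x" using permutes_inv_o(1)[OF t_perm] by (simp only: comp_id)
    finally show ?thesis .
  qed
  show ?thesis
    unfolding real_hyperbolic_pair_def s
    using pair t_perm sign_cycles_perm[OF ct(1)] inverts[OF perms(1) t(1)] inverts[OF perms(2) t(2)] by blast
qed

lemma generate_if_three_cycle:
  assumes "even_cycles n cx" "even_cycles n cy"
    and "cycle_of_list [a, b, c] \<in> generate (alt_group n) {cycles_perm cx, cycles_perm cy}" "distinct [a, b, c]"
    and "\<exists>i \<in> {a, b, c}. cycles_perm cx i \<in> {a, b, c}" "\<exists>i \<in> {a, b, c}. cycles_perm cy i \<in> {a, b, c}"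
    and "\<And>S. a \<in> S \<Longrightarrow>
      (\<And>d e. d \<in> set cx \<union> set cy \<Longrightarrow> e \<in> set d \<Longrightarrow> e \<in> S \<Longrightarrow> set d \<subseteq> S) \<Longrightarrow> {1..n} \<subseteq> S"
  shows "generate (alt_group n) {cycles_perm cx, cycles_perm cy} = carrier (alt_group n)"
proof -
  note H = generate_subgroup[OF cycles_perm_in_alt_group[OF assms(1)] cycles_perm_in_alt_group[OF assms(2)]]
  have d: "distinct (concat cx)" "distinct (concat cy)"
    using assms(1,2) by (simp_all only: even_cycles_def)
  show ?thesis
  proof (rule eq_alt_group_if_three_cycle[OF H(1) assms(3,4), where K = "{cycles_perm cx, cycles_perm cy}"])
    fix S assume S: "a \<in> S" "\<And>g i. g \<in> {cycles_perm cx, cycles_perm cy} \<Longrightarrow> i \<in> S \<Longrightarrow> g i \<in> S"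
    show "{1..n} \<subseteq> S"
    proof (rule assms(7)[OF S(1)])
      fix c e assume c: "c \<in> set cx \<union> set cy" "e \<in> set c" "e \<in> S"
      have x: "cycles_perm cx i \<in> S" and y: "cycles_perm cy i \<in> S" if "i \<in> S" for i
        using S(2) that by simp_all
      show "set c \<subseteq> S"
      proof (cases "c \<in> set cx")
        case True
        then show ?thesis using cycles_perm_closed_set[OF d(1) _ c(2,3) x] by simp
      next
        case False
        then show ?thesis using cycles_perm_closed_set[OF d(2) _ c(2,3) y] c(1) by simp
      qed
    qed
  next
    fix g assume "g \<in> {cycles_perm cx, cycles_perm cy}"
    then consider "g = cycles_perm cx" | "g = cycles_perm cy" by blast
    then show "\<exists>i \<in> {a, b, c}. g i \<in> {a, b, c}"
      by cases (simp_all only: assms(5,6))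
  qed (use H in simp)
qed

text \<open>The list \<open>w\<close> spells a word in the generators and their inverses whose value is the 3-cycle \<open>(a b c)\<close>.
A set closed under both generators contains every cycle that it meets, which reduces
transitivity to a short chain of overlapping cycles.\<close>

lemma generate_if_word:
  assumes ns: "[1..<Suc n] = ns"
    and even: "even_cycles n cx" "even_cycles n cy"
    and w: "set w \<subseteq> {cx, cy, map rev cx, map rev cy}"
    and eq: "foldr (\<lambda>cs. map (cycles_perm cs)) w ns = map (cycle_of_list [a, b, c]) ns"
    and abc: "distinct [a, b, c]" "set [a, b, c] \<subseteq> {1..n}"
    and meets: "i \<in> {a, b, c}" "cycles_perm cx i \<in> {a, b, c}" "j \<in> {a, b, c}" "cycles_perm cy j \<in> {a, b, c}"
    and trans: "\<And>S. a \<in> S \<Longrightarrow> (\<And>d e. d \<in> set cx \<union> set cy \<Longrightarrow> e \<in> set d \<Longrightarrow> e \<in> S \<Longrightarrow> set d \<subseteq> S)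
      \<Longrightarrow> set ns \<subseteq> S"
  shows "generate (alt_group n) {cycles_perm cx, cycles_perm cy} = carrier (alt_group n)"
proof (rule generate_if_three_cycle[OF even _ abc(1)])
  let ?H = "generate (alt_group n) {cycles_perm cx, cycles_perm cy}"
  note H = generate_subgroup[OF cycles_perm_in_alt_group[OF even(1)] cycles_perm_in_alt_group[OF even(2)]]
  have d: "distinct (concat cx)" "distinct (concat cy)"
    using even by (simp_all only: even_cycles_def)
  have gens: "cycles_perm cs \<in> ?H" if "cs \<in> {cx, cy, map rev cx, map rev cy}" for cs
  proof -
    have "cycles_perm (map rev cx) \<in> ?H" "cycles_perm (map rev cy) \<in> ?H"
      using inv_closed[OF H(1) H(2)] inv_closed[OF H(1) H(3)]
      unfolding inv_cycles_perm[OF d(1)] inv_cycles_perm[OF d(2)] .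
    then show ?thesis using that H(2,3) by blast
  qed
  from w have word: "(\<lambda>i. foldr cycles_perm w i) \<in> ?H"
  proof (induction w)
    case Nil
    then show ?case using subgroup.one_closed[OF H(1)] by (simp add: alt_group_one id_def)
  next
    case (Cons cs w)
    then have "cycles_perm cs \<circ> (\<lambda>i. foldr cycles_perm w i) \<in> ?H"
      by (intro comp_closed[OF H(1)] gens) auto
    then show ?case by (simp add: comp_def)
  qed
  have fold_map: "foldr (\<lambda>cs. map (cycles_perm cs)) w is = map (\<lambda>i. foldr cycles_perm w i) is" for "is"
    by (induction w) simp_all
  have "(\<lambda>i. foldr cycles_perm w i) = cycle_of_list [a, b, c]"
    by (rule permutes_eqI[OF permutes_mem[OF H(1) word] permutes_subset[OF cycle_permutes abc(2)]])
      (use eq fold_map in \<open>simp only: ns\<close>)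
  then show "cycle_of_list [a, b, c] \<in> ?H" using word by simp
  show "\<exists>i \<in> {a, b, c}. cycles_perm cx i \<in> {a, b, c}" by (rule bexI[where x = i]; fact meets)
  show "\<exists>i \<in> {a, b, c}. cycles_perm cy i \<in> {a, b, c}" by (rule bexI[where x = j]; fact meets)
  show "{1..n} \<subseteq> S" if "a \<in> S" "\<And>d e. d \<in> set cx \<union> set cy \<Longrightarrow> e \<in> set d \<Longrightarrow> e \<in> S \<Longrightarrow> set d \<subseteq> S" for S
    using trans[OF that] unfolding ns[symmetric] by (simp only: set_upt atLeastLessThanSuc_atLeastAtMost)
qed

text \<open>Each pair in this section comes with a word in its members that is a 3-cycle (the argument \<open>w\<close>) and, except
in degree six, with an involution \<open>ct\<close> that inverts both of them. Its numbers of moved points must differ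
from those of the pair that it is combined with. In degrees 8, 9 and 11 this is the pair whose product is a 3-cycle, with
numbers 7, 3 or \<open>n\<close>, \<open>n - 2\<close>, 3; in degree 7 the three 5-cycles given here are combined with permutations
of cycle types 3-2-2, 7 and 3-2-2.\<close>

lemma real_hyperbolic_pair_7_first: "real_hyperbolic_pair 7 {5} (- 1)"
proof -
  let ?cx = "[[1, 2, 4, 3, 6]] :: nat list list" and ?cy = "[[3, 4, 7, 5, 6]] :: nat list list"
  have ns: "[1..<Suc 7] = [1, 2, 3, 4, 5, 6, 7]" by (simp add: upt_conv_Cons)
  have even: "even_cycles 7 ?cx" "even_cycles 7 ?cy" by code_simp+
  have gen: "generate (alt_group 7) {cycles_perm ?cx, cycles_perm ?cy} = carrier (alt_group 7)"
  proof (rule generate_if_word[OF ns even, where w = "[?cx, ?cx, map rev ?cy, ?cx, ?cx, map rev ?cy]"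
        and a = 5 and b = 6 and c = 7 and i = 5 and j = 5])
    fix S :: "nat set"
    assume "5 \<in> S"
      and S: "\<And>d e. d \<in> set ?cx \<union> set ?cy \<Longrightarrow> e \<in> set d \<Longrightarrow> e \<in> S \<Longrightarrow> set d \<subseteq> S"
    then have "set [3, 4, 7, 5, 6] \<subseteq> S" using S[of "[3, 4, 7, 5, 6]" 5] by simp
    moreover from this have "set [1, 2, 4, 3, 6] \<subseteq> S" using S[of "[1, 2, 4, 3, 6]" 4] by simp
    ultimately show "set [1, 2, 3, 4, 5, 6, 7] \<subseteq> S" by simp
  qed (simp_all add: cycle_of_list.simps(1))
  have pair: "hyperbolic_pair 7 {5} (cycles_perm ?cx) (cycles_perm ?cy)"
  proof (rule hyperbolic_pair_if_cycles[OF ns even _ _ _ gen, where cw = "[[1, 2, 4, 7, 5]]"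
        and a = "[1, 2, 4, 3, 6]" and b = "[3, 4, 7, 5, 6]" and c = "[1, 2, 4, 7, 5]"])
    show "moved_count cs j \<in> insert 0 {5}" if "cs \<in> {?cx, ?cy, [[1, 2, 4, 7, 5]]}" for cs j
      using that by (auto simp: moved_count_def split: if_splits)
  qed (simp_all add: cycle_of_list.simps(1))
  show ?thesis
    by (rule real_hyperbolic_pair_if_cycles[OF ns pair, where ct = "[[1, 2], [4, 6], [5, 7]]"])
      (simp_all add: cycle_of_list.simps(1))
qed

lemma real_hyperbolic_pair_7_second: "real_hyperbolic_pair 7 {3, 4, 7} (- 1)"
proof -
  let ?cx = "[[1, 2], [3, 6], [4, 7, 5]] :: nat list list" and ?cy = "[[1, 4, 2, 3, 7, 5, 6]] :: nat list list"
  have ns: "[1..<Suc 7] = [1, 2, 3, 4, 5, 6, 7]" by (simp add: upt_conv_Cons)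
  have even: "even_cycles 7 ?cx" "even_cycles 7 ?cy" by code_simp+
  have gen: "generate (alt_group 7) {cycles_perm ?cx, cycles_perm ?cy} = carrier (alt_group 7)"
  proof (rule generate_if_word[OF ns even, where w = "[?cx, ?cx]"
        and a = 4 and b = 5 and c = 7 and i = 4 and j = 7])
    fix S :: "nat set"
    assume "4 \<in> S"
      and S: "\<And>d e. d \<in> set ?cx \<union> set ?cy \<Longrightarrow> e \<in> set d \<Longrightarrow> e \<in> S \<Longrightarrow> set d \<subseteq> S"
    then have "set [1, 4, 2, 3, 7, 5, 6] \<subseteq> S" using S[of "[1, 4, 2, 3, 7, 5, 6]" 4] by simp
    then show "set [1, 2, 3, 4, 5, 6, 7] \<subseteq> S" by simp
  qed (simp_all add: cycle_of_list.simps(1))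
  have pair: "hyperbolic_pair 7 {3, 4, 7} (cycles_perm ?cx) (cycles_perm ?cy)"
  proof (rule hyperbolic_pair_if_cycles[OF ns even _ _ _ gen, where cw = "[[1, 7, 4], [2, 6], [3, 5]]"
        and a = "[4, 7, 5]" and b = "[1, 4, 2, 3, 7, 5, 6]" and c = "[1, 7, 4]"])
    show "moved_count cs j \<in> insert 0 {3, 4, 7}" if "cs \<in> {?cx, ?cy, [[1, 7, 4], [2, 6], [3, 5]]}" for cs j
      using that by (auto simp: moved_count_def split: if_splits)
  qed (simp_all add: cycle_of_list.simps(1))
  show ?thesis
    by (rule real_hyperbolic_pair_if_cycles[OF ns pair, where ct = "[[1, 2], [3, 6], [5, 7]]"])
      (simp_all add: cycle_of_list.simps(1))
qed

lemma real_hyperbolic_pair_8: "real_hyperbolic_pair 8 {2, 4, 6, 8} (- 1)"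
proof -
  let ?cx = "[[1, 5, 4, 3], [2, 7]] :: nat list list" and ?cy = "[[1, 8, 5, 6], [2, 3, 4, 7]] :: nat list list"
  have ns: "[1..<Suc 8] = [1, 2, 3, 4, 5, 6, 7, 8]" by (simp add: upt_conv_Cons)
  have even: "even_cycles 8 ?cx" "even_cycles 8 ?cy" by code_simp+
  have gen: "generate (alt_group 8) {cycles_perm ?cx, cycles_perm ?cy} = carrier (alt_group 8)"
  proof (rule generate_if_word[OF ns even, where w = "[?cx, map rev ?cy, ?cx, map rev ?cy]"
        and a = 1 and b = 4 and c = 6 and i = 6 and j = 6])
    fix S :: "nat set"
    assume "1 \<in> S"
      and S: "\<And>d e. d \<in> set ?cx \<union> set ?cy \<Longrightarrow> e \<in> set d \<Longrightarrow> e \<in> S \<Longrightarrow> set d \<subseteq> S"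
    then have "set [1, 5, 4, 3] \<subseteq> S" using S[of "[1, 5, 4, 3]" 1] by simp
    moreover from this have "set [1, 8, 5, 6] \<subseteq> S" using S[of "[1, 8, 5, 6]" 1] by simp
    moreover have "set [2, 3, 4, 7] \<subseteq> S" using S[of "[2, 3, 4, 7]" 3] calculation by simp
    ultimately show "set [1, 2, 3, 4, 5, 6, 7, 8] \<subseteq> S" by simp
  qed (simp_all add: cycle_of_list.simps(1))
  have pair: "hyperbolic_pair 8 {2, 4, 6, 8} (cycles_perm ?cx) (cycles_perm ?cy)"
  proof (rule hyperbolic_pair_if_cycles[OF ns even _ _ _ gen, where cw = "[[1, 8, 4, 2], [5, 6]]"
        and a = "[1, 5, 4, 3]" and b = "[1, 8, 5, 6]" and c = "[1, 8, 4, 2]"])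
    show "moved_count cs j \<in> insert 0 {2, 4, 6, 8}" if "cs \<in> {?cx, ?cy, [[1, 8, 4, 2], [5, 6]]}" for cs j
      using that by (auto simp: moved_count_def split: if_splits)
  qed (simp_all add: cycle_of_list.simps(1))
  show ?thesis
    by (rule real_hyperbolic_pair_if_cycles[OF ns pair, where ct = "[[1, 5], [2, 7], [3, 4]]"])
      (simp_all add: cycle_of_list.simps(1))
qed

lemma real_hyperbolic_pair_9: "real_hyperbolic_pair 9 {2, 5, 6, 8} 1"
proof -
  let ?cx = "[[1, 6, 5, 4, 7]] :: nat list list" and ?cy = "[[1, 3, 8, 2, 9, 6], [5, 7]] :: nat list list"
  have ns: "[1..<Suc 9] = [1, 2, 3, 4, 5, 6, 7, 8, 9]" by (simp add: upt_conv_Cons)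
  have even: "even_cycles 9 ?cx" "even_cycles 9 ?cy" by code_simp+
  have gen: "generate (alt_group 9) {cycles_perm ?cx, cycles_perm ?cy} = carrier (alt_group 9)"
  proof (rule generate_if_word[OF ns even, where w = "[?cx, map rev ?cy, ?cx, ?cy]"
        and a = 1 and b = 6 and c = 9 and i = 1 and j = 6])
    fix S :: "nat set"
    assume "1 \<in> S"
      and S: "\<And>d e. d \<in> set ?cx \<union> set ?cy \<Longrightarrow> e \<in> set d \<Longrightarrow> e \<in> S \<Longrightarrow> set d \<subseteq> S"
    then have "set [1, 3, 8, 2, 9, 6] \<subseteq> S" using S[of "[1, 3, 8, 2, 9, 6]" 1] by simp
    moreover from this have "set [1, 6, 5, 4, 7] \<subseteq> S" using S[of "[1, 6, 5, 4, 7]" 1] by simp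
    ultimately show "set [1, 2, 3, 4, 5, 6, 7, 8, 9] \<subseteq> S" by simp
  qed (simp_all add: cycle_of_list.simps(1))
  have pair: "hyperbolic_pair 9 {2, 5, 6, 8} (cycles_perm ?cx) (cycles_perm ?cy)"
  proof (rule hyperbolic_pair_if_cycles[OF ns even _ _ _ gen, where cw = "[[1, 3, 8, 2, 9, 5], [4, 7]]"
        and a = "[1, 6, 5, 4, 7]" and b = "[1, 3, 8, 2, 9, 6]" and c = "[1, 3, 8, 2, 9, 5]"])
    show "moved_count cs j \<in> insert 0 {2, 5, 6, 8}" if "cs \<in> {?cx, ?cy, [[1, 3, 8, 2, 9, 5], [4, 7]]}" for cs j
      using that by (auto simp: moved_count_def split: if_splits)
  qed (simp_all add: cycle_of_list.simps(1))
  show ?thesis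
    by (rule real_hyperbolic_pair_if_cycles[OF ns pair, where ct = "[[1, 6], [2, 8], [3, 9], [5, 7]]"])
      (simp_all add: cycle_of_list.simps(1))
qed

lemma real_hyperbolic_pair_11: "real_hyperbolic_pair 11 {2, 4, 6, 7, 8, 10} (- 1)"
proof -
  let ?cx = "[[1, 10, 7, 11, 4, 5, 6]] :: nat list list" and ?cy = "[[1, 2, 10, 11, 3, 4], [5, 8, 9, 6]] :: nat list list"
  have ns: "[1..<Suc 11] = [1, 2, 3, 4, 5, 6, 7, 8, 9, 10, 11]" by (simp add: upt_conv_Cons)
  have even: "even_cycles 11 ?cx" "even_cycles 11 ?cy" by code_simp+
  have gen: "generate (alt_group 11) {cycles_perm ?cx, cycles_perm ?cy} = carrier (alt_group 11)"
  proof (rule generate_if_word[OF ns even, where w = "[?cx, map rev ?cy, ?cx, map rev ?cy]"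
        and a = 6 and b = 8 and c = 9 and i = 8 and j = 8])
    fix S :: "nat set"
    assume "6 \<in> S"
      and S: "\<And>d e. d \<in> set ?cx \<union> set ?cy \<Longrightarrow> e \<in> set d \<Longrightarrow> e \<in> S \<Longrightarrow> set d \<subseteq> S"
    then have "set [1, 10, 7, 11, 4, 5, 6] \<subseteq> S" using S[of "[1, 10, 7, 11, 4, 5, 6]" 6] by simp
    moreover from this have "set [1, 2, 10, 11, 3, 4] \<subseteq> S" using S[of "[1, 2, 10, 11, 3, 4]" 1] by simp
    moreover have "set [5, 8, 9, 6] \<subseteq> S" using S[of "[5, 8, 9, 6]" 5] calculation by simp
    ultimately show "set [1, 2, 3, 4, 5, 6, 7, 8, 9, 10, 11] \<subseteq> S" by simp
  qed (simp_all add: cycle_of_list.simps(1))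
  have pair: "hyperbolic_pair 11 {2, 4, 6, 7, 8, 10} (cycles_perm ?cx) (cycles_perm ?cy)"
  proof (rule hyperbolic_pair_if_cycles[OF ns even _ _ _ gen, where cw = "[[1, 2, 7, 11, 3, 5, 8, 9], [4, 10]]"
        and a = "[1, 10, 7, 11, 4, 5, 6]" and b = "[1, 2, 10, 11, 3, 4]" and c = "[1, 2, 7, 11, 3, 5, 8, 9]"])
    show "moved_count cs j \<in> insert 0 {2, 4, 6, 7, 8, 10}" if "cs \<in> {?cx, ?cy, [[1, 2, 7, 11, 3, 5, 8, 9], [4, 10]]}" for cs j
      using that by (auto simp: moved_count_def split: if_splits)
  qed (simp_all add: cycle_of_list.simps(1))
  show ?thesis
    by (rule real_hyperbolic_pair_if_cycles[OF ns pair, where ct = "[[1, 4], [2, 3], [5, 6], [8, 9], [10, 11]]"])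
      (simp_all add: cycle_of_list.simps(1))
qed

text \<open>In degree six a pair of triples with cycle types 5, 5, 5 and 4-2, 4-2, 4-2 is used.\<close>

lemma hyperbolic_pair_6_first:
  "hyperbolic_pair 6 {5} (cycles_perm [[2, 3, 5, 6, 4]]) (cycles_perm [[1, 2, 4, 3, 6]])"
proof -
  let ?cx = "[[2, 3, 5, 6, 4]] :: nat list list" and ?cy = "[[1, 2, 4, 3, 6]] :: nat list list"
  have ns: "[1..<Suc 6] = [1, 2, 3, 4, 5, 6]" by (simp add: upt_conv_Cons)
  have even: "even_cycles 6 ?cx" "even_cycles 6 ?cy" by code_simp+
  have gen: "generate (alt_group 6) {cycles_perm ?cx, cycles_perm ?cy} = carrier (alt_group 6)"
  proof (rule generate_if_word[OF ns even, where w = "[?cx, ?cy, ?cy, map rev ?cx, map rev ?cy]"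
        and a = 1 and b = 6 and c = 5 and i = 1 and j = 6])
    fix S :: "nat set"
    assume "1 \<in> S"
      and S: "\<And>d e. d \<in> set ?cx \<union> set ?cy \<Longrightarrow> e \<in> set d \<Longrightarrow> e \<in> S \<Longrightarrow> set d \<subseteq> S"
    then have "set [1, 2, 4, 3, 6] \<subseteq> S" using S[of "[1, 2, 4, 3, 6]" 1] by simp
    moreover from this have "set [2, 3, 5, 6, 4] \<subseteq> S" using S[of "[2, 3, 5, 6, 4]" 2] by simp
    ultimately show "set [1, 2, 3, 4, 5, 6] \<subseteq> S" by simp
  qed (simp_all add: cycle_of_list.simps(1))
  show ?thesis
  proof (rule hyperbolic_pair_if_cycles[OF ns even _ _ _ gen, where cw = "[[1, 3, 4, 5, 6]]"
        and a = "[2, 3, 5, 6, 4]" and b = "[1, 2, 4, 3, 6]" and c = "[1, 3, 4, 5, 6]"])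
    show "moved_count cs j \<in> insert 0 {5}" if "cs \<in> {?cx, ?cy, [[1, 3, 4, 5, 6]]}" for cs j
      using that by (auto simp: moved_count_def split: if_splits)
  qed (simp_all add: cycle_of_list.simps(1))
qed

lemma hyperbolic_pair_6_second:
  "hyperbolic_pair 6 {2, 4, 6}
    (cycles_perm [[1, 2], [3, 5, 4, 6]]) (cycles_perm [[1, 3, 4, 6], [2, 5]])"
proof -
  let ?cx = "[[1, 2], [3, 5, 4, 6]] :: nat list list" and ?cy = "[[1, 3, 4, 6], [2, 5]] :: nat list list"
  have ns: "[1..<Suc 6] = [1, 2, 3, 4, 5, 6]" by (simp add: upt_conv_Cons)
  have even: "even_cycles 6 ?cx" "even_cycles 6 ?cy" by code_simp+
  have gen: "generate (alt_group 6) {cycles_perm ?cx, cycles_perm ?cy} = carrier (alt_group 6)"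
  proof (rule generate_if_word[OF ns even, where w = "[?cx, ?cx, map rev ?cy, map rev ?cx, ?cy]"
        and a = 1 and b = 3 and c = 2 and i = 1 and j = 1])
    fix S :: "nat set"
    assume "1 \<in> S"
      and S: "\<And>d e. d \<in> set ?cx \<union> set ?cy \<Longrightarrow> e \<in> set d \<Longrightarrow> e \<in> S \<Longrightarrow> set d \<subseteq> S"
    then have "set [1, 3, 4, 6] \<subseteq> S" using S[of "[1, 3, 4, 6]" 1] by simp
    moreover from this have "set [1, 2] \<subseteq> S" using S[of "[1, 2]" 1] by simp
    moreover have "set [3, 5, 4, 6] \<subseteq> S" using S[of "[3, 5, 4, 6]" 3] calculation by simp
    ultimately show "set [1, 2, 3, 4, 5, 6] \<subseteq> S" by simp
  qed (simp_all add: cycle_of_list.simps(1))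
  show ?thesis
  proof (rule hyperbolic_pair_if_cycles[OF ns even _ _ _ gen, where cw = "[[1, 5], [2, 4, 3, 6]]"
        and a = "[3, 5, 4, 6]" and b = "[1, 3, 4, 6]" and c = "[2, 4, 3, 6]"])
    show "moved_count cs j \<in> insert 0 {2, 4, 6}" if "cs \<in> {?cx, ?cy, [[1, 5], [2, 4, 3, 6]]}" for cs j
      using that by (auto simp: moved_count_def split: if_splits)
  qed (simp_all add: cycle_of_list.simps(1))
qed

section \<open>An outer automorphism in degree six\<close>

text \<open>An automorphism inverting given elements is constructed from an action. Suppose that each element \<open>g\<close>
of \<open>K\<close> permutes the objects \<open>T 1, \<dots>, T n\<close> as \<open>inv g\<close> permutes their indices. As \<open>K\<close> contains generators,
every even permutation acts on the objects through an even permutation of the indices, and this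
assignment is a homomorphism. It squares to the identity on the generators, so it is bijective.\<close>

lemma automorphism_of_action:
  fixes act :: "(nat \<Rightarrow> nat) \<Rightarrow> 'b \<Rightarrow> 'b" and T :: "nat \<Rightarrow> 'b"
  assumes act: "\<And>p q u. act (p \<circ> q) u = act p (act q u)" "\<And>u. act id u = u"
    and T: "inj_on T {1..n}"
    and gen: "generate (alt_group n) {x, y} = carrier (alt_group n)"
    and inverts: "\<And>g i. g \<in> K \<Longrightarrow> i \<in> {1..n} \<Longrightarrow> act g (T i) = T (inv' g i)"
    and K: "{x, y} \<subseteq> K" "K \<subseteq> carrier (alt_group n)"
  shows "\<exists>\<phi> \<in> carrier (AutoGroup (alt_group n)). \<forall>g \<in> K. \<phi> g = inv' g"
proof -
  let ?G = "alt_group n"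
  interpret A: group ?G by (rule alt_group_is_group)
  define R where "R g h \<longleftrightarrow> (\<forall>i \<in> {1..n}. act g (T i) = T (h i))" for g h
  have R_unique: "h = h'" if "R g h" "R g h'" "h \<in> carrier ?G" "h' \<in> carrier ?G" for g h h'
  proof
    fix i
    have perms: "h permutes {1..n}" "h' permutes {1..n}" using that(3,4) alt_group_carrier by auto
    show "h i = h' i"
    proof (cases "i \<in> {1..n}")
      case True
      then have "T (h i) = T (h' i)" using that(1,2) unfolding R_def by metis
      moreover have "h i \<in> {1..n}" "h' i \<in> {1..n}" using True permutes_in_image[OF perms(1)] permutes_in_image[OF perms(2)] by blast+
      ultimately show ?thesis using T by (meson inj_onD)
    next
      case False
      then show ?thesis using permutes_not_in[OF perms(1) False] permutes_not_in[OF perms(2) False] by simp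
    qed
  qed
  have R_comp: "R (g \<circ> g') (h \<circ> h')" if "R g h" "R g' h'" "h' \<in> carrier ?G" for g g' h h'
  proof -
    have "h' permutes {1..n}" using that(3) alt_group_carrier by blast
    from permutes_in_image[OF this] show ?thesis using that(1,2) unfolding R_def act by simp
  qed
  have R_inv: "R (inv' g) (inv' h)" if "R g h" "g \<in> carrier ?G" "h \<in> carrier ?G" for g h
  proof -
    have g: "inv' g \<circ> g = id" using that(2) permutes_inv_o(2) alt_group_carrier by blast
    have h: "h permutes {1..n}" using that(3) alt_group_carrier by blast
    show ?thesis unfolding R_def
    proof
      fix i assume i: "i \<in> {1..n}"
      then have "inv' h i \<in> {1..n}" using permutes_in_image[OF permutes_inv[OF h]] by blast
      then have "act g (T (inv' h i)) = T i" using that(1) permutes_inverses(1)[OF h] unfolding R_def by metis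
      then have "act (inv' g) (T i) = act (inv' g \<circ> g) (T (inv' h i))" by (simp only: act)
      then show "act (inv' g) (T i) = T (inv' h i)" unfolding g act .
    qed
  qed
  have R_K: "R g (inv' g)" if "g \<in> K" for g
    using inverts[OF that] unfolding R_def by blast
  have K_inv: "inv' g \<in> carrier ?G" if "g \<in> K" for g using K(2) that alt_group_inv_closed by blast
  have xy: "x \<in> carrier ?G" "y \<in> carrier ?G" using K by auto
  let ?D = "{g \<in> carrier ?G. \<exists>h \<in> carrier ?G. R g h}"
  have "subgroup ?D ?G"
  proof (rule A.subgroupI)
    have "R id id" unfolding R_def act by simp
    then show "?D \<noteq> {}" using A.one_closed unfolding alt_group_one by blast
    show "inv\<^bsub>?G\<^esub> g \<in> ?D" if D: "g \<in> ?D" for g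
    proof -
      obtain h where h: "h \<in> carrier ?G" "R g h" and g: "g \<in> carrier ?G" using D by blast
      have "R (inv' g) (inv' h)" by (rule R_inv[OF h(2) g h(1)])
      moreover have "inv' g \<in> carrier ?G" "inv' h \<in> carrier ?G" using g h by (simp_all add: alt_group_inv_closed)
      ultimately show ?thesis unfolding alt_group_inv_equality[OF g] by blast
    qed
    show "g \<otimes>\<^bsub>?G\<^esub> g' \<in> ?D" if D: "g \<in> ?D" "g' \<in> ?D" for g g'
    proof -
      obtain h h' where h: "h \<in> carrier ?G" "R g h" "h' \<in> carrier ?G" "R g' h'"
        and g: "g \<in> carrier ?G" "g' \<in> carrier ?G"
        using D by auto
      have "g \<circ> g' \<in> carrier ?G" "h \<circ> h' \<in> carrier ?G"
        using A.m_closed[OF g] A.m_closed[OF h(1,3)] by (simp_all add: alt_group_mult)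
      then show ?thesis using R_comp[OF h(2,4,3)] unfolding alt_group_mult by blast
    qed
  qed auto
  moreover have "{x, y} \<subseteq> ?D" using xy R_K K_inv K(1) by blast
  ultimately have "carrier ?G \<subseteq> ?D"
    using A.generate_subgroup_incl[of "{x, y}" ?D] unfolding gen by blast
  then have "\<forall>g \<in> carrier ?G. \<exists>h. h \<in> carrier ?G \<and> R g h" by blast
  then obtain \<psi> where \<psi>: "\<And>g. g \<in> carrier ?G \<Longrightarrow> \<psi> g \<in> carrier ?G" "\<And>g. g \<in> carrier ?G \<Longrightarrow> R g (\<psi> g)"
    by metis
  let ?\<phi> = "restrict \<psi> (carrier ?G)"
  have \<psi>_comp: "\<psi> (g \<circ> g') = \<psi> g \<circ> \<psi> g'" if "g \<in> carrier ?G" "g' \<in> carrier ?G" for g g'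
  proof -
    have "g \<circ> g' \<in> carrier ?G" "\<psi> g \<circ> \<psi> g' \<in> carrier ?G"
      using A.m_closed[OF that] A.m_closed[OF \<psi>(1)[OF that(1)] \<psi>(1)[OF that(2)]] by (simp_all add: alt_group_mult)
    then show ?thesis
      using R_unique[OF \<psi>(2) R_comp[OF \<psi>(2) \<psi>(2) \<psi>(1)]] \<psi>(1) that by blast
  qed
  have \<psi>_K: "\<psi> g = inv' g" if "g \<in> K" for g
    using R_unique[OF \<psi>(2) R_K[OF that] \<psi>(1) K_inv[OF that]] K(2) that by blast
  have \<psi>_inv: "\<psi> (inv' g) = inv' (\<psi> g)" if "g \<in> carrier ?G" for g
    using R_unique[OF \<psi>(2) R_inv[OF \<psi>(2) that] \<psi>(1)] \<psi>(1) that alt_group_inv_closed by blast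
  let ?F = "{g \<in> carrier ?G. \<psi> (\<psi> g) = g}"
  have "subgroup ?F ?G"
  proof (rule A.subgroupI)
    have "\<psi> id = id"
      using R_unique[OF \<psi>(2) _ \<psi>(1), of id id] A.one_closed unfolding alt_group_one R_def act by simp
    then show "?F \<noteq> {}" using A.one_closed unfolding alt_group_one by force
    show "inv\<^bsub>?G\<^esub> g \<in> ?F" if "g \<in> ?F" for g
    proof -
      have g: "g \<in> carrier ?G" "\<psi> (\<psi> g) = g" using that by auto
      then have "\<psi> (\<psi> (inv' g)) = inv' g" using \<psi>_inv[OF g(1)] \<psi>_inv[OF \<psi>(1)[OF g(1)]] by simp
      then show ?thesis using alt_group_inv_closed[OF g(1)] unfolding alt_group_inv_equality[OF g(1)] by blast
    qed
    show "g \<otimes>\<^bsub>?G\<^esub> g' \<in> ?F" if "g \<in> ?F" "g' \<in> ?F" for g g'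
    proof -
      have g: "g \<in> carrier ?G" "\<psi> (\<psi> g) = g" "g' \<in> carrier ?G" "\<psi> (\<psi> g') = g'" using that by auto
      then have "\<psi> (\<psi> (g \<circ> g')) = g \<circ> g'" using \<psi>_comp[OF g(1,3)] \<psi>_comp[OF \<psi>(1)[OF g(1)] \<psi>(1)[OF g(3)]] by simp
      then show ?thesis using A.m_closed[OF g(1,3)] unfolding alt_group_mult by blast
    qed
  qed auto
  moreover have "{x, y} \<subseteq> ?F"
  proof -
    have "\<psi> (\<psi> g) = g" if "g \<in> K" for g
    proof -
      have g: "g \<in> carrier ?G" using that K(2) by blast
      have "\<psi> (\<psi> g) = inv' (inv' g)" unfolding \<psi>_K[OF that] \<psi>_inv[OF g] ..
      also have "\<dots> = g" using g alt_group_carrier permutes_inv_inv by blast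
      finally show ?thesis .
    qed
    then show ?thesis using K(1) xy by blast
  qed
  ultimately have "carrier ?G \<subseteq> ?F"
    using A.generate_subgroup_incl[of "{x, y}" ?F] unfolding gen by blast
  then have "bij_betw \<psi> (carrier ?G) (carrier ?G)"
    using \<psi>(1) by (intro bij_betw_byWitness[where f' = \<psi>]) auto
  then have "bij_betw ?\<phi> (carrier ?G) (carrier ?G)" by simp
  moreover have "?\<phi> \<in> hom ?G ?G"
  proof (rule homI)
    fix g g' assume g: "g \<in> carrier ?G" "g' \<in> carrier ?G"
    then have "g \<circ> g' \<in> carrier ?G" using A.m_closed[OF g] by (simp add: alt_group_mult)
    then show "?\<phi> (g \<otimes>\<^bsub>?G\<^esub> g') = ?\<phi> g \<otimes>\<^bsub>?G\<^esub> ?\<phi> g'"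
      using g \<psi>_comp[OF g] by (simp only: alt_group_mult restrict_apply if_True)
  qed (use \<psi>(1) in simp)
  ultimately have "?\<phi> \<in> carrier (AutoGroup ?G)"
    unfolding AutoGroup_def auto_def Bij_def by simp
  moreover have "?\<phi> g = inv' g" if "g \<in> K" for g
    using \<psi>_K[OF that] K(2) that by auto
  ultimately show ?thesis by blast
qed

text \<open>The six synthematic totals of \<open>{1..6}\<close>: the partitions of the fifteen pairs into five perfect matchings. The
action of permutations on the totals yields the outer automorphisms of the symmetric group of
degree six. The totals are numbered so that \<open>total_act\<close> holds, that is, so that the resulting
automorphism inverts the members of the two pairs of degree six.\<close>

definition total :: "nat \<Rightarrow> nat set set set"
  where "total i = [
    {{{1,4},{2,6},{3,5}}, {{1,2},{3,4},{5,6}}, {{1,3},{2,5},{4,6}}, {{1,5},{2,4},{3,6}}, {{1,6},{2,3},{4,5}}},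
    {{{1,3},{2,6},{4,5}}, {{1,4},{2,5},{3,6}}, {{1,6},{2,4},{3,5}}, {{1,2},{3,4},{5,6}}, {{1,5},{2,3},{4,6}}},
    {{{1,6},{2,5},{3,4}}, {{1,4},{2,6},{3,5}}, {{1,2},{3,6},{4,5}}, {{1,3},{2,4},{5,6}}, {{1,5},{2,3},{4,6}}},
    {{{1,2},{3,6},{4,5}}, {{1,6},{2,4},{3,5}}, {{1,3},{2,5},{4,6}}, {{1,4},{2,3},{5,6}}, {{1,5},{2,6},{3,4}}},
    {{{1,2},{3,5},{4,6}}, {{1,4},{2,5},{3,6}}, {{1,3},{2,4},{5,6}}, {{1,6},{2,3},{4,5}}, {{1,5},{2,6},{3,4}}},
    {{{1,2},{3,5},{4,6}}, {{1,6},{2,5},{3,4}}, {{1,3},{2,6},{4,5}}, {{1,5},{2,4},{3,6}}, {{1,4},{2,3},{5,6}}}] ! (i - 1)"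

lemma total_act:
  assumes "i \<in> {1, 2, 3, 4, 5, 6}"
    and "cs \<in> {[[2, 3, 5, 6, 4]], [[1, 2, 4, 3, 6]], [[1, 2], [3, 5, 4, 6]], [[1, 3, 4, 6], [2, 5]]}"
  shows "(`) ((`) (cycles_perm cs)) ` total i = total (cycles_perm (map rev cs) i)"
  using assms by (elim insertE emptyE; hypsubst; code_simp)

lemma inj_on_total: "inj_on total {1..6}"
proof -
  have "distinct (map total [1, 2, 3, 4, 5, 6])" by code_simp
  then have "inj_on total (set [1, 2, 3, 4, 5, 6])" unfolding distinct_map by blast
  moreover have "set [1, 2, 3, 4, 5, 6] = {1..6::nat}" by auto
  ultimately show ?thesis by (simp only:)
qed

text \<open>Conjugation by permutations does not suffice here: among the hyperbolic generating triples
that are inverted by a permutation of the six points, the sets of conjugates of powers of any two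
share a nontrivial element.\<close>

lemma strongly_real_alt_group_6: "strongly_real_beauville_group (alt_group 6)"
proof -
  let ?x1 = "[[2, 3, 5, 6, 4]] :: nat list list" and ?y1 = "[[1, 2, 4, 3, 6]] :: nat list list"
  let ?x2 = "[[1, 2], [3, 5, 4, 6]] :: nat list list" and ?y2 = "[[1, 3, 4, 6], [2, 5]] :: nat list list"
  let ?K = "cycles_perm ` {?x1, ?y1, ?x2, ?y2}"
  note pairs = hyperbolic_pair_6_first hyperbolic_pair_6_second
  have K: "?K \<subseteq> carrier (alt_group 6)" using pairs unfolding hyperbolic_pair_def by blast
  have gen: "generate (alt_group 6) {cycles_perm ?x1, cycles_perm ?y1} = carrier (alt_group 6)"
    using pairs(1) unfolding hyperbolic_pair_def by blast
  have "\<exists>\<phi> \<in> carrier (AutoGroup (alt_group 6)). \<forall>g \<in> ?K. \<phi> g = inv' g"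
  proof (rule automorphism_of_action[where act = "\<lambda>p u. (`) ((`) p) ` u", OF _ _ inj_on_total gen _ _ K])
    show "(`) ((`) (p \<circ> q)) ` u = (`) ((`) p) ` ((`) ((`) q) ` u)"
      for p q :: "nat \<Rightarrow> nat" and u :: "nat set set set"
      by (simp add: image_image comp_def)
    show "(`) ((`) id) ` u = u" for u :: "nat set set set" by (simp add: id_def)
    fix g i assume "g \<in> ?K" and i: "i \<in> {1..6::nat}"
    then obtain cs where cs: "cs \<in> {?x1, ?y1, ?x2, ?y2}" "g = cycles_perm cs" by blast
    have "distinct (concat cs)" using cs(1) by auto
    moreover have "i \<in> {1, 2, 3, 4, 5, 6}" using i by auto
    ultimately show "(`) ((`) g) ` total i = total (inv' g i)"
      unfolding cs(2) using total_act[OF _ cs(1)] inv_cycles_perm by metis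
  qed auto
  then obtain \<phi> where \<phi>: "\<phi> \<in> carrier (AutoGroup (alt_group 6))" "\<And>g. g \<in> ?K \<Longrightarrow> \<phi> g = inv' g" by blast
  show ?thesis
    by (rule strongly_real_alt_group_if_auto[OF pairs _ \<phi>(1)]; (rule \<phi>(2))?) simp_all
qed

section \<open>Degrees at most five\<close>

text \<open>Fixed points appear as cycles of length one, so that the cycles cover the whole set.\<close>

lemma ex_cycles_perm:
  assumes "p permutes A" "finite A"
  shows "\<exists>cs. p = cycles_perm cs \<and> distinct (concat cs) \<and> set (concat cs) = A \<and> [] \<notin> set cs"
  using cycle_decomposition[OF assms]
proof induction
  case empty
  show ?case by (rule exI[of _ "[]"]) simp
next
  case (comp I p c)
  then obtain cs where cs: "p = cycles_perm cs" "distinct (concat cs)" "set (concat cs) = I" "[] \<notin> set cs" by blast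
  show ?case
  proof (cases "c = []")
    case True
    then show ?thesis using cs by (intro exI[of _ cs]) auto
  next
    case False
    then show ?thesis using cs comp.hyps by (intro exI[of _ "c # cs"]) auto
  qed
qed

text \<open>If \<open>l\<close> does not divide 2 and \<open>m\<close> does not divide 3, with \<open>l\<close> and \<open>m\<close> below 5, then \<open>l\<close> is 3 or 4 and \<open>m\<close> is 2
or 4. The lengths are then 4, or 3 and 2, up to ones, and in both cases the permutation is odd.\<close>

lemma cycle_lengths_at_most_five:
  fixes ls :: "nat list"
  assumes pos: "0 \<notin> set ls" and sum: "sum_list ls \<le> 5" and even: "even (\<Sum>l\<leftarrow>ls. l - 1)"
  shows "5 \<in> set ls \<or> (\<forall>l \<in> set ls. l dvd 2) \<or> (\<forall>l \<in> set ls. l dvd 3)"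
proof (rule ccontr)
  assume "\<not> ?thesis"
  then obtain l m where l: "l \<in> set ls" "\<not> l dvd 2" and m: "m \<in> set ls" "\<not> m dvd 3" and five: "5 \<notin> set ls"
    by blast
  have ones: "(\<Sum>k\<leftarrow>ks. k - 1) = 0" if "sum_list ks \<le> 1" for ks :: "nat list"
    using that by (induction ks) auto
  have small: "k \<le> 4 \<and> k \<noteq> 0" if k: "k \<in> set ls" for k
  proof -
    have "k \<le> 5" using member_le_sum_list[OF k] sum by simp
    moreover have "k \<noteq> 5" using k five by metis
    moreover have "k \<noteq> 0" using k pos by metis
    ultimately show ?thesis by simp
  qed
  have l34: "l = 3 \<or> l = 4" using small[OF l(1)] l(2) by (auto simp: le_Suc_eq numeral_eq_Suc)
  have m24: "m = 2 \<or> m = 4" using small[OF m(1)] m(2) by (auto simp: le_Suc_eq numeral_eq_Suc)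
  let ?r = "remove1 l ls"
  have sums: "sum_list ls = l + sum_list ?r" "(\<Sum>k\<leftarrow>ls. k - 1) = (l - 1) + (\<Sum>k\<leftarrow>?r. k - 1)"
    using sum_list_map_remove1[OF l(1), of id] sum_list_map_remove1[OF l(1), of "\<lambda>k. k - 1"] by simp_all
  show False
  proof (cases "l = m")
    case True
    then have "l = 4" using l34 m24 by auto
    then have "(\<Sum>k\<leftarrow>ls. k - 1) = 3" using sums ones[of ?r] sum by simp
    then show False using even by simp
  next
    case False
    let ?s = "remove1 m ?r"
    have mr: "m \<in> set ?r" using m(1) False by simp
    have sums': "sum_list ?r = m + sum_list ?s" "(\<Sum>k\<leftarrow>?r. k - 1) = (m - 1) + (\<Sum>k\<leftarrow>?s. k - 1)"
      using sum_list_map_remove1[OF mr, of id] sum_list_map_remove1[OF mr, of "\<lambda>k. k - 1"] by simp_all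
    have lm: "l = 3 \<and> m = 2 \<and> sum_list ?s \<le> 1" using l34 m24 sums(1) sums'(1) sum False by linarith
    have "(\<Sum>k\<leftarrow>?s. k - 1) = 0" by (rule ones) (use lm in blast)
    then have "(\<Sum>k\<leftarrow>ls. k - 1) = (l - 1) + ((m - 1) + 0)" by (simp only: sums(2) sums'(2))
    also have "\<dots> = 3" using lm by simp
    finally have "(\<Sum>k\<leftarrow>ls. k - 1) = 3" .
    then show False using even by simp
  qed
qed

lemma five_cycle_or_ord_le_3:
  assumes n: "n \<le> 5" and p: "p \<in> carrier (alt_group n)"
  shows "(\<exists>c. distinct c \<and> length c = 5 \<and> set c = {1..n} \<and> p = cycle_of_list c)
    \<or> group.ord (alt_group n) p \<in> {1..3}"
proof -
  interpret A: group "alt_group n" by (rule alt_group_is_group)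
  obtain cs where cs: "p = cycles_perm cs" "distinct (concat cs)" "set (concat cs) = {1..n}" "[] \<notin> set cs"
    using ex_cycles_perm[of p "{1..n}"] p alt_group_carrier by blast
  have len: "(\<Sum>c\<leftarrow>cs. length c) = n"
    using distinct_card[OF cs(2)] unfolding cs(3) by (simp add: length_concat)
  have sign: "(- 1 :: int) ^ (\<Sum>c\<leftarrow>cs. length c - 1) = 1"
    using sign_cycles_perm[OF cs(2)] p unfolding cs(1) alt_group_carrier_sign by simp
  have "even (\<Sum>c\<leftarrow>cs. length c - 1)"
  proof (rule ccontr)
    assume "odd (\<Sum>c\<leftarrow>cs. length c - 1)"
    then show False using sign by simp
  qed
  then have even: "even (\<Sum>l\<leftarrow>map length cs. l - 1)" by (simp add: comp_def)
  have "5 \<in> set (map length cs) \<or> (\<forall>l \<in> set (map length cs). l dvd 2) \<or> (\<forall>l \<in> set (map length cs). l dvd 3)"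
    by (rule cycle_lengths_at_most_five[OF _ _ even]) (use cs(4) len n in auto)
  then consider c where "c \<in> set cs" "length c = 5" | k where "k \<in> {2, 3}" "\<And>c. c \<in> set cs \<Longrightarrow> length c dvd k"
    by auto
  then show ?thesis
  proof cases
    case (1 c)
    obtain xs ys where split: "cs = xs @ c # ys" using split_list[OF 1(1)] by blast
    have "xs = []" "ys = []"
    proof -
      have "sum_list (map length xs) + sum_list (map length ys) = 0"
        using len n 1(2) unfolding split map_append list.map sum_list_append sum_list.Cons by linarith
      then show "xs = []" "ys = []" using cs(4) unfolding split by (cases xs; cases ys; simp)+
    qed
    then show ?thesis using cs 1(2) unfolding split by auto
  next
    case (2 k)
    have "moved_count cs k = 0" unfolding moved_count_def using 2(2) by (induction cs) auto
    then have "p ^^ k = id"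
      using eq_id_if_card_moved_eq_0[OF permutes_funpow[OF cycles_perm_permutes[of cs], of k]]
        card_moved_cycles_perm_funpow[OF cs(2), of k] unfolding cs(1) by simp
    then have "group.ord (alt_group n) p dvd k"
      using A.pow_eq_id[OF p, of k] by (simp add: alt_group_nat_pow alt_group_one)
    moreover have "0 < k" "k \<le> 3" using 2(1) by auto
    ultimately have "group.ord (alt_group n) p \<le> 3" "0 < group.ord (alt_group n) p"
      using dvd_imp_le[of "group.ord (alt_group n) p" k] dvd_pos_nat[of k "group.ord (alt_group n) p"]
      by linarith+
    then show ?thesis by simp
  qed
qed

text \<open>Without a 5-cycle all orders are at most 3 and the sum of their reciprocals is at least 1.\<close>

lemma five_cycle_in_hyperbolic_triple:
  assumes n: "n \<le> 5" and hyp: "hyperbolic_generating_triple (alt_group n) x y z"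
  shows "\<exists>u \<in> {x, y, z}. \<exists>c. distinct c \<and> length c = 5 \<and> set c = {1..n} \<and> u = cycle_of_list c"
proof (rule ccontr)
  let ?o = "\<lambda>u. real (group.ord (alt_group n) u)"
  assume contr: "\<not> ?thesis"
  have "1 / ?o u \<ge> 1 / 3" if u: "u \<in> {x, y, z}" for u
  proof -
    have "u \<in> carrier (alt_group n)" using u hyp unfolding hyperbolic_generating_triple_def by auto
    then have "group.ord (alt_group n) u \<in> {1..3}" using five_cycle_or_ord_le_3[OF n] contr u by blast
    then show ?thesis by (intro divide_left_mono) auto
  qed
  from this[of x] this[of y] this[of z] have "1 / ?o x + 1 / ?o y + 1 / ?o z \<ge> 1" by simp
  then show False using hyp unfolding hyperbolic_generating_triple_def by simp
qed

lemma ex_permutes_map_eq: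
  assumes "distinct xs" "distinct ys" "set xs = set ys"
  shows "\<exists>g. g permutes set xs \<and> map g xs = ys"
proof -
  have len: "length xs = length ys" using assms distinct_card by metis
  let ?g = "permutation_of_list (zip xs ys)"
  have perm: "list_permutes (zip xs ys) (set xs)"
    unfolding list_permutes_def using len assms by simp
  have "?g (xs ! i) = ys ! i" if "i < length xs" for i
    using permutation_of_list_unique[OF perm, of "xs ! i" "ys ! i"] that len by (force simp: set_zip)
  then have "map ?g xs = ys" using len by (auto intro: nth_equalityI)
  then show ?thesis using permutation_of_list_permutes[OF perm] by blast
qed

text \<open>The normalizer of a 5-cycle \<open>c\<close> in the symmetric group contains a 4-cycle that conjugates the square of \<open>c\<close>
to \<open>c\<close>. It is odd, so an odd permutation taking \<open>c\<close> to \<open>d\<close> can be corrected to an even one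
at the price of replacing \<open>c\<close> by its square.\<close>

lemma five_cycles_conjugate:
  assumes c: "distinct c" "length c = 5" "set c = {1..n}" and d: "distinct d" "set d = {1..n}"
  shows "\<exists>g \<in> carrier (alt_group n). \<exists>j. g \<circ> cycle_of_list c ^^ j \<circ> inv' g = cycle_of_list d"
proof -
  obtain g where g: "g permutes {1..n}" "map g c = d"
    using ex_permutes_map_eq[OF c(1) d(1)] c(3) d(2) by auto
  show ?thesis
  proof (cases "evenperm g")
    case True
    then have "g \<in> carrier (alt_group n)" using g(1) alt_group_carrier by blast
    moreover have "g \<circ> cycle_of_list c ^^ 1 \<circ> inv' g = cycle_of_list d"
      using conjugation_of_cycle[OF c(1) permutes_bij[OF g(1)]] g(2) by simp
    ultimately show ?thesis by blast
  next
    case False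
    obtain c1 c2 c3 c4 c5 where c_eq: "c = [c1, c2, c3, c4, c5]"
      using c(2) by (auto simp: length_Suc_conv numeral_eq_Suc)
    let ?h = "cycle_of_list [c2, c4, c5, c3]"
    let ?c' = "[c1, c3, c5, c2, c4]"
    have dist: "distinct [c1, c2, c3, c4, c5]" "distinct (rev [c1, c2, c3, c4, c5])" using c(1) c_eq by auto
    have sq: "cycle_of_list c ^^ 2 = cycle_of_list ?c'"
    proof
      fix i
      consider "i = c1" | "i = c2" | "i = c3" | "i = c4" | "i = c5" | "i \<notin> {c1, c2, c3, c4, c5}" by blast
      then show "(cycle_of_list c ^^ 2) i = cycle_of_list ?c' i"
        unfolding c_eq by cases (use dist in \<open>simp_all add: numeral_2_eq_2 cycle_of_list.simps(1) transpose_def\<close>)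
    qed
    have h: "map ?h ?c' = c"
      unfolding c_eq using dist by (simp add: cycle_of_list.simps(1) transpose_def)
    have h_perm: "?h permutes {1..n}"
      by (rule permutes_subset[OF cycle_permutes]) (use c(3) c_eq in auto)
    have "\<not> evenperm ?h"
      using sign_cycle_of_list[of "[c2, c4, c5, c3]"] dist sign_one_iff_evenperm[of ?h] by simp
    then have "evenperm (g \<circ> ?h)"
      using False evenperm_comp[of g ?h] g(1) permutation_of_cycle permutation_permutes
      by (metis finite_atLeastAtMost)
    moreover have perm: "g \<circ> ?h permutes {1..n}" by (rule permutes_compose[OF h_perm g(1)])
    ultimately have "g \<circ> ?h \<in> carrier (alt_group n)" using alt_group_carrier by blast
    moreover have "map (g \<circ> ?h) ?c' = d" using h g(2) by (metis list.map_comp)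
    then have "(g \<circ> ?h) \<circ> cycle_of_list c ^^ 2 \<circ> inv' (g \<circ> ?h) = cycle_of_list d"
      unfolding sq using conjugation_of_cycle[OF _ permutes_bij[OF perm], of ?c'] dist by auto
    ultimately show ?thesis by blast
  qed
qed

lemma not_beauville_if_le_5:
  assumes n: "n \<le> 5"
  shows "\<not> unmixed_beauville_structure (alt_group n) (x1, y1, z1) (x2, y2, z2)"
proof
  assume b: "unmixed_beauville_structure (alt_group n) (x1, y1, z1) (x2, y2, z2)"
  then have hyp: "hyperbolic_generating_triple (alt_group n) x1 y1 z1"
    "hyperbolic_generating_triple (alt_group n) x2 y2 z2"
    and disj: "conjugacy_union (alt_group n) x1 y1 z1 \<inter> conjugacy_union (alt_group n) x2 y2 z2 = {\<one>\<^bsub>alt_group n\<^esub>}"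
    unfolding unmixed_beauville_structure_def by simp_all
  obtain u c where u: "u \<in> {x1, y1, z1}" "u = cycle_of_list c" and c: "distinct c" "length c = 5" "set c = {1..n}"
    using five_cycle_in_hyperbolic_triple[OF n hyp(1)] by blast
  obtain v d where v: "v \<in> {x2, y2, z2}" "v = cycle_of_list d" and d: "distinct d" "length d = 5" "set d = {1..n}"
    using five_cycle_in_hyperbolic_triple[OF n hyp(2)] by blast
  have union: "g \<circ> w ^^ j \<circ> inv' g \<in> conjugacy_union (alt_group n) x y z"
    if "g \<in> carrier (alt_group n)" "w \<in> {x, y, z}" for g w j x y z
    using that unfolding conjugacy_union_def alt_group_mult alt_group_nat_pow
    by (auto simp: alt_group_inv_equality)
  obtain g j where g: "g \<in> carrier (alt_group n)" "g \<circ> u ^^ j \<circ> inv' g = v"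
    using five_cycles_conjugate[OF c d(1,3)] u(2) v(2) by blast
  have "v \<in> conjugacy_union (alt_group n) x1 y1 z1" using union[OF g(1) u(1), of j] g(2) by simp
  moreover have "v \<in> conjugacy_union (alt_group n) x2 y2 z2"
  proof -
    have "id \<in> carrier (alt_group n)" 
      using group.is_monoid[OF alt_group_is_group, of n] monoid.one_closed[of "alt_group n"] by (simp add: alt_group_one)
    from union[OF this v(1), of 1] show ?thesis by simp
  qed
  ultimately have "v = id" using disj unfolding alt_group_one by blast
  moreover have "{a. (v ^^ 1) a \<noteq> a} = set d"
    using moved_cycle_of_list_funpow[OF d(1), of 1] d(2) v(2) by simp
  ultimately show False using d(2) by auto
qed

section \<open>Strongly real alternating groups\<close>

theorem corollary10:
  fixes n :: nat
  assumes "n \<ge> 1"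
  shows "strongly_real_beauville_group (alt_group n) \<longleftrightarrow> n \<ge> 6"
proof
  assume "strongly_real_beauville_group (alt_group n)"
  then obtain t1 t2 where "strongly_real_beauville_structure (alt_group n) t1 t2"
    unfolding strongly_real_beauville_group_def by blast
  moreover obtain x1 y1 z1 x2 y2 z2 where "t1 = (x1, y1, z1)" "t2 = (x2, y2, z2)"
    by (metis prod_cases3)
  ultimately have "unmixed_beauville_structure (alt_group n) (x1, y1, z1) (x2, y2, z2)"
    unfolding strongly_real_beauville_structure_def by simp
  then have "\<not> n \<le> 5" using not_beauville_if_le_5 by blast
  then show "n \<ge> 6" by simp
next
  assume n: "n \<ge> 6"
  consider "n = 6" | "n = 7" | "n = 8" | "n = 9" | "n = 11" | "even n" "n \<ge> 10" | "odd n" "n \<ge> 13"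
  proof -
    have "n = 6 \<or> n = 7 \<or> n = 8 \<or> n = 9 \<or> n = 11 \<or> (even n \<and> n \<ge> 10) \<or> (odd n \<and> n \<ge> 13)"
      using n by presburger
    then show thesis using that by blast
  qed
  then show "strongly_real_beauville_group (alt_group n)"
  proof cases
    case 1
    then show ?thesis using strongly_real_alt_group_6 by simp
  next
    case 2
    then show ?thesis
      using strongly_real_if_real_hyperbolic_pairs[OF real_hyperbolic_pair_7_first real_hyperbolic_pair_7_second] by simp
  next
    case 3
    then have "real_hyperbolic_pair 8 {7, 3} (- 1)" using real_hyperbolic_pair_even_three_cycle[of 8] by simp
    from strongly_real_if_real_hyperbolic_pairs[OF this real_hyperbolic_pair_8] show ?thesis using 3 by simp
  next
    case 4
    then have "real_hyperbolic_pair 9 {9, 7, 3} 1" using real_hyperbolic_pair_odd_three_cycle[of 9] by simp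
    from strongly_real_if_real_hyperbolic_pairs[OF this real_hyperbolic_pair_9] show ?thesis using 4 by simp
  next
    case 5
    then have "real_hyperbolic_pair 11 {11, 9, 3} (- 1)" using real_hyperbolic_pair_odd_three_cycle[of 11] by simp
    from strongly_real_if_real_hyperbolic_pairs[OF this real_hyperbolic_pair_11] show ?thesis using 5 by simp
  next
    case 6
    show ?thesis
      by (rule strongly_real_if_real_hyperbolic_pairs[OF real_hyperbolic_pair_even_three_cycle real_hyperbolic_pair_even_seven_cycle])
        (use 6 in auto)
  next
    case 7
    show ?thesis
      by (rule strongly_real_if_real_hyperbolic_pairs[OF real_hyperbolic_pair_odd_three_cycle real_hyperbolic_pair_odd_nine_cycle])
        (use 7 in auto)
  qed
qed

end
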